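(* For any $\epsilon>0$, there is an algorithm for the stochastic knapsack problem with unlimited copies whose running time is linear in $n$ (for fixed capacity $\mathbb{C}$) and polynomial in $1/\epsilon$, and which finds a policy whose expected profit, when run with capacity $\mathbb{C}+\epsilon$, is at least $(1-\epsilon)\mathsf{OPT}$, where $\mathsf{OPT}$ is the maximum expected profit of an adaptive policy with capacity $\mathbb{C}$.
   Context: Stochastic knapsack with unlimited copies: there are $n$ item types; type $b$ has a random size $X_b$ (supported in $[0,\mathbb{C}]$) and random profit $P_b$ with an explicitly given discrete joint distribution, and each type has an unlimited number of copies, each copy having an independent realization of (size, profit). The knapsack capacity is $\mathbb{C}$. An adaptive policy repeatedly chooses a type and inserts a fresh copy of it, whose size and profit are revealed on insertion; if the total inserted size exceeds the capacity the process stops and that copy's profit is not collected, otherwise the profit is collected. The value of a policy is its expected total collected profit. *)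

theory Defs
  imports "HOL-Probability.Probability"
begin

section \<open>The stochastic knapsack problem with unlimited copies\<close>

text \<open>An outcome of an insertion is a pair (size, profit). An item type is its joint distribution,
  given explicitly as a list of pairs (outcome, probability); an instance lists the item types
  \<open>0, \<dots>, n - 1\<close>.\<close>

type_synonym outcome = "real \<times> real"
type_synonym item_type = "(outcome \<times> real) list"
type_synonym history = "outcome list"

definition valid_instance :: "real \<Rightarrow> item_type list \<Rightarrow> bool" where
  "valid_instance C I \<longleftrightarrow> I \<noteq> [] \<and>
     (\<forall>b\<in>set I. pmf_of_list_wf b \<and> (\<forall>((x, p), w)\<in>set b. 0 \<le> x \<and> x \<le> C \<and> 0 \<le> p))"

definition total_size :: "history \<Rightarrow> real" where
  "total_size h = (\<Sum>(x, p)\<leftarrow>h. x)"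

definition total_profit :: "history \<Rightarrow> real" where
  "total_profit h = (\<Sum>(x, p)\<leftarrow>h. p)"

text \<open>An adaptive policy chooses the next type from the outcomes observed so far. The types chosen
  earlier are themselves determined by the earlier outcomes.\<close>

type_synonym policy = "history \<Rightarrow> nat"

definition policies :: "item_type list \<Rightarrow> policy set" where
  "policies I = {\<pi>. \<forall>h. \<pi> h < length I}"

text \<open>The state of the process after \<open>k\<close> rounds: the outcomes of the copies that have been packed,
  and whether the capacity has been exceeded. The overflowing copy is not packed.\<close>

primrec run :: "item_type list \<Rightarrow> real \<Rightarrow> policy \<Rightarrow> nat \<Rightarrow> (history \<times> bool) pmf" where
  "run I cap \<pi> 0 = return_pmf ([], False)"
| "run I cap \<pi> (Suc k) = bind_pmf (run I cap \<pi> k) (\<lambda>(h, stopped).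
     if stopped then return_pmf (h, True)
     else bind_pmf (pmf_of_list (I ! \<pi> h)) (\<lambda>(x, p).
       if total_size h + x \<le> cap then return_pmf (h @ [(x, p)], False)
       else return_pmf (h, True)))"

text \<open>Sizes may be zero, so the process need not stop. Profits being nonnegative, the profit
  collected within \<open>k\<close> rounds increases with \<open>k\<close>, and by monotone convergence the supremum below is
  the expected total profit. It is infinite, for example, when a type with size constantly \<open>0\<close> and
  positive expected profit is inserted forever.\<close>

definition policy_value :: "item_type list \<Rightarrow> real \<Rightarrow> policy \<Rightarrow> ennreal" where
  "policy_value I cap \<pi> =
     (SUP k. \<integral>\<^sup>+ z. ennreal (total_profit (fst z)) \<partial>measure_pmf (run I cap \<pi> k))"

definition OPT :: "item_type list \<Rightarrow> real \<Rightarrow> ennreal" where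
  "OPT I cap = (SUP \<pi>\<in>policies I. policy_value I cap \<pi>)"

text \<open>Histories that occur with positive probability before the capacity is exceeded.\<close>

definition reachable :: "item_type list \<Rightarrow> real \<Rightarrow> policy \<Rightarrow> history set" where
  "reachable I cap \<pi> = {h. \<exists>k. (h, False) \<in> set_pmf (run I cap \<pi> k)}"


section \<open>Algorithms: programs for a unit-cost real RAM\<close>

text \<open>Memory consists of arrays of naturals and arrays of reals; a scalar variable is cell \<open>0\<close> of an
  array. Array names are fixed in the program text, indices are computed. To prevent unit-cost
  arithmetic from hiding work, naturals have no multiplication, and reals have neither rounding
  nor a conversion to naturals.\<close>

record memory =
  nats :: "nat \<Rightarrow> nat \<Rightarrow> nat"
  reals :: "nat \<Rightarrow> nat \<Rightarrow> real"

datatype nexp =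
    NConst nat
  | NCell nat nexp
  | NPlus nexp nexp
  | NMinus nexp nexp

datatype rexp =
    RConst rat
  | RCell nat nexp
  | ROfNat nexp
  | RPlus rexp rexp
  | RMinus rexp rexp
  | RTimes rexp rexp
  | RDivide rexp rexp

datatype bexp =
    NLess nexp nexp
  | RLess rexp rexp
  | BNot bexp
  | BAnd bexp bexp

datatype com =
    Skip
  | NAssign nat nexp nexp
  | RAssign nat nexp rexp
  | Seq com com
  | Cond bexp com com
  | While bexp com

primrec nval :: "memory \<Rightarrow> nexp \<Rightarrow> nat" where
  "nval s (NConst k) = k"
| "nval s (NCell a e) = nats s a (nval s e)"
| "nval s (NPlus e f) = nval s e + nval s f"
| "nval s (NMinus e f) = nval s e - nval s f"

primrec rval :: "memory \<Rightarrow> rexp \<Rightarrow> real" where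
  "rval s (RConst q) = of_rat q"
| "rval s (RCell a e) = reals s a (nval s e)"
| "rval s (ROfNat e) = real (nval s e)"
| "rval s (RPlus e f) = rval s e + rval s f"
| "rval s (RMinus e f) = rval s e - rval s f"
| "rval s (RTimes e f) = rval s e * rval s f"
| "rval s (RDivide e f) = rval s e / rval s f"

primrec bval :: "memory \<Rightarrow> bexp \<Rightarrow> bool" where
  "bval s (NLess e f) \<longleftrightarrow> nval s e < nval s f"
| "bval s (RLess e f) \<longleftrightarrow> rval s e < rval s f"
| "bval s (BNot b) \<longleftrightarrow> \<not> bval s b"
| "bval s (BAnd b c) \<longleftrightarrow> bval s b \<and> bval s c"

definition nat_update :: "nat \<Rightarrow> nat \<Rightarrow> nat \<Rightarrow> memory \<Rightarrow> memory" where
  "nat_update a i v s = s\<lparr>nats := (nats s)(a := (nats s a)(i := v))\<rparr>"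

definition real_update :: "nat \<Rightarrow> nat \<Rightarrow> real \<Rightarrow> memory \<Rightarrow> memory" where
  "real_update a i v s = s\<lparr>reals := (reals s)(a := (reals s a)(i := v))\<rparr>"

text \<open>\<open>exec c s t s'\<close>: started in \<open>s\<close>, the program \<open>c\<close> halts in \<open>s'\<close> after time \<open>t\<close>. Assignments and
  tests cost one unit; the expressions in them have a size fixed by the program text.\<close>

inductive exec :: "com \<Rightarrow> memory \<Rightarrow> nat \<Rightarrow> memory \<Rightarrow> bool" where
  Skip: "exec Skip s 1 s"
| NAssign: "exec (NAssign a i e) s 1 (nat_update a (nval s i) (nval s e) s)"
| RAssign: "exec (RAssign a i e) s 1 (real_update a (nval s i) (rval s e) s)"
| Seq: "exec c s t s' \<Longrightarrow> exec d s' u s'' \<Longrightarrow> exec (Seq c d) s (t + u) s''"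
| CondTrue: "bval s b \<Longrightarrow> exec c s t s' \<Longrightarrow> exec (Cond b c d) s (t + 1) s'"
| CondFalse: "\<not> bval s b \<Longrightarrow> exec d s t s' \<Longrightarrow> exec (Cond b c d) s (t + 1) s'"
| WhileFalse: "\<not> bval s b \<Longrightarrow> exec (While b c) s 1 s"
| WhileTrue: "bval s b \<Longrightarrow> exec c s t s' \<Longrightarrow> exec (While b c) s' u s'' \<Longrightarrow>
    exec (While b c) s (t + u + 1) s''"

lemma exec_deterministic:
  assumes "exec c s t s'" and "exec c s u s''"
  shows "t = u \<and> s' = s''"
  using assms
proof (induction arbitrary: u s'' rule: exec.induct)
  case (Skip s)
  then show ?case by cases simp
next
  case (NAssign a i e s)
  then show ?case by cases simp
next
  case (RAssign a i e s)
  then show ?case by cases simp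
next
  case (Seq c s t s' d v r)
  from Seq.prems show ?case by cases (metis Seq.IH)
next
  case (CondTrue s b c t s' d)
  from CondTrue.prems show ?case by cases (metis CondTrue.IH, metis CondTrue.hyps(1))
next
  case (CondFalse s b d t s' c)
  from CondFalse.prems show ?case by cases (metis CondFalse.hyps(1), metis CondFalse.IH)
next
  case (WhileFalse s b c)
  from WhileFalse.prems show ?case by cases (simp, metis WhileFalse.hyps)
next
  case (WhileTrue s b c t s' v r)
  from WhileTrue.prems show ?case by cases (metis WhileTrue.hyps(1), metis WhileTrue.IH)
qed


section \<open>Algorithms that find a policy\<close>

text \<open>Input format: the outcomes of all types are stored consecutively in the real arrays
  \<open>2\<close> (sizes), \<open>3\<close> (profits) and \<open>4\<close> (probabilities); the natural array \<open>1\<close> holds the number of outcomes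
  of each type. Unused cells are zero.\<close>

definition initial_memory :: "real \<Rightarrow> real \<Rightarrow> item_type list \<Rightarrow> memory" where
  "initial_memory C \<epsilon> I =
    (let A = concat I in
     \<lparr>nats = (\<lambda>a i.
        if a = 0 \<and> i = 0 then length I
        else if a = 1 \<and> i < length I then length (I ! i)
        else 0),
      reals = (\<lambda>a i.
        if a = 0 \<and> i = 0 then C
        else if a = 1 \<and> i = 0 then \<epsilon>
        else if a = 2 \<and> i < length A then fst (fst (A ! i))
        else if a = 3 \<and> i < length A then snd (fst (A ! i))
        else if a = 4 \<and> i < length A then snd (A ! i)
        else 0)\<rparr>)"

definition decision :: "memory \<Rightarrow> nat" where
  "decision s = nats s 2 0"

definition observe :: "outcome \<Rightarrow> memory \<Rightarrow> memory" where
  "observe z s = real_update 6 0 (snd z) (real_update 5 0 (fst z) s)"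

text \<open>A policy is represented by a memory content together with a program that, after each insertion,
  reads the observed outcome, updates the memory and thereby determines the next decision.
  \<open>responds step T s h s'\<close>: from \<open>s\<close>, observing the outcomes in \<open>h\<close> one after the other leads to \<open>s'\<close>,
  with each update taking time at most \<open>T\<close>.\<close>

inductive responds :: "com \<Rightarrow> real \<Rightarrow> memory \<Rightarrow> history \<Rightarrow> memory \<Rightarrow> bool"
  for step T s where
  Nil: "responds step T s [] s"
| snoc: "responds step T s h s' \<Longrightarrow> exec step (observe z s') t s'' \<Longrightarrow> real t \<le> T \<Longrightarrow>
    responds step T s (h @ [z]) s''"

text \<open>The program \<open>plan\<close> computes, in time at most \<open>T\<close>, a representation of \<open>\<pi>\<close> from the input. The
  bound on the time of each subsequent decision is needed: otherwise all of the computation could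
  be deferred to the execution of the policy. The last argument \<open>cap\<close> is the capacity with which
  the policy is going to be run.\<close>

definition finds_policy ::
  "com \<Rightarrow> com \<Rightarrow> real \<Rightarrow> real \<Rightarrow> item_type list \<Rightarrow> real \<Rightarrow> policy \<Rightarrow> real \<Rightarrow> bool" where
  "finds_policy plan step C \<epsilon> I T \<pi> cap \<longleftrightarrow>
     (\<exists>t s. exec plan (initial_memory C \<epsilon> I) t s \<and> real t \<le> T \<and>
        (\<forall>h\<in>reachable I cap \<pi>. \<exists>s'. responds step T s h s' \<and> decision s' = \<pi> h))"

text \<open>The number of outcomes listed in the input. It is at most \<open>m * n\<close> when each of the \<open>n\<close> types
  has at most \<open>m\<close> outcomes.\<close>

definition input_size :: "item_type list \<Rightarrow> nat" where
  "input_size I = (\<Sum>b\<leftarrow>I. length b)"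

lemma length_le_input_size:
  assumes "valid_instance C I"
  shows "length I \<le> input_size I"
proof -
  have "b \<noteq> []" if "b \<in> set I" for b
    using assms that by (auto simp: valid_instance_def pmf_of_list_wf_def)
  then have "(\<Sum>b\<leftarrow>I. 1) \<le> (\<Sum>b\<leftarrow>I. length b)"
    by (intro sum_list_mono) (simp add: Suc_le_eq)
  then show ?thesis by (simp add: input_size_def sum_list_triv)
qed

lemma input_size_le:
  assumes "\<And>b. b \<in> set I \<Longrightarrow> length b \<le> m"
  shows "input_size I \<le> m * length I"
proof -
  have "(\<Sum>b\<leftarrow>I. length b) \<le> (\<Sum>b\<leftarrow>I. m)"
    using assms by (intro sum_list_mono)
  then show ?thesis by (simp add: input_size_def sum_list_triv mult.commute)
qed

end

theory Submission
  imports Defs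
begin

text \<open>Round every size \<open>x = (k + f) \<delta>\<close> with \<open>0 \<le> f \<le> 1\<close> to \<open>k \<delta>\<close> or \<open>(k + 1) \<delta>\<close> with
  probabilities \<open>1 - f\<close> and \<open>f\<close>. The optimal values \<open>v j\<close> of the rounded problem satisfy a Bellman
  equation on the grid \<open>0, \<delta>, \<dots>, J \<delta>\<close>, which one pass over the grid solves exactly. Rounding
  errors do not add up linearly: they form a martingale whose variance is at most \<open>\<delta>\<close> times the
  total size. If the rounded problem has capacity \<open>C + a\<close> and the real one \<open>C + 2 a = C + \<epsilon>\<close>, then by a
  second moment argument either direction of the simulation (the optimal policy for \<open>C\<close> by rounded
  policies, and those by a policy for \<open>C + \<epsilon>\<close>) loses at most a fraction of about \<open>\<delta> C / a\<^sup>2\<close> of the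
  value, because a failed simulation cannot lose more than the whole value. The second moment
  argument is carried out with a quadratic potential, and a policy that rounds so as to maximize the
  potential needs no randomness.\<close>

subsection \<open>Expected values for explicitly listed distributions\<close>

text \<open>Sizes have no positive lower bound, so the number of insertions is unbounded and a
  biased rounding could drift without limit; hence the unbiased one. Small sizes may then round to
  0: a grid point can lead back to itself, and its value occurs on both sides of its Bellman
  equation. Solving for it gives a maximum of quotients, \<open>gain\<close> over
  \<open>turn\<close>, that involve smaller grid points only. The denominator vanishes exactly for
  types whose size is almost surely 0; a profitable one makes the optimum infinite, so these types
  are treated apart. Because of the loops, a solution of the Bellman equation need not obviously be
  the value of the policy read off from it; a small term \<open>\<theta>\<close> per unit of
  consumed size forces progress. Constants: with \<open>a = \<epsilon> / 2\<close> and
  \<open>\<delta> = (C + a) / J\<close>, each direction of the simulation loses at most a fraction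
  \<open>\<epsilon> / 2\<close> once
  \<open>\<delta> (C + \<epsilon>) \<le> \<epsilon> a\<^sup>2 / 2\<close>, that is,
  \<open>8 (C + \<epsilon>) (C + \<epsilon> / 2) \<le> J \<epsilon>^3\<close>. Planning takes time
  of order \<open>J^2\<close> times the input size, whence the exponent 6.\<close>

definition expect :: "item_type \<Rightarrow> (real \<Rightarrow> real \<Rightarrow> real) \<Rightarrow> real" where
  "expect b g = (\<Sum>q<length b. snd (b ! q) * g (fst (fst (b ! q))) (snd (fst (b ! q))))"

lemma expect_add: "expect b (\<lambda>x p. g x p + h x p) = expect b g + expect b h"
  by (simp add: expect_def sum.distrib ring_distribs)

lemma expect_cmult: "expect b (\<lambda>x p. c * g x p) = c * expect b g"
  by (simp add: expect_def sum_distrib_left mult_ac)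

lemma valid_instanceD:
  assumes "valid_instance C I" "b \<in> set I" "q < length b"
  shows "0 \<le> fst (fst (b ! q))" "fst (fst (b ! q)) \<le> C" "0 \<le> snd (fst (b ! q))" "0 \<le> snd (b ! q)"
proof -
  have w: "pmf_of_list_wf b" and *: "\<forall>((x, p), w)\<in>set b. 0 \<le> x \<and> x \<le> C \<and> 0 \<le> p"
    using assms by (auto simp: valid_instance_def)
  have "b ! q \<in> set b"
    using assms by simp
  with * have "(\<lambda>((x, p), w). 0 \<le> x \<and> x \<le> C \<and> 0 \<le> p) (b ! q)"
    by (rule bspec)
  then show "0 \<le> fst (fst (b ! q))" "fst (fst (b ! q)) \<le> C" "0 \<le> snd (fst (b ! q))"
    by (auto split: prod.splits)
  show "0 \<le> snd (b ! q)"
    using w \<open>b ! q \<in> set b\<close> by (auto simp: pmf_of_list_wf_def)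
qed

lemma expect_mono:
  assumes "valid_instance C I" "b \<in> set I"
    and "\<And>x p. 0 \<le> x \<Longrightarrow> x \<le> C \<Longrightarrow> 0 \<le> p \<Longrightarrow> g x p \<le> h x p"
  shows "expect b g \<le> expect b h"
  unfolding expect_def
  by (intro sum_mono mult_left_mono assms valid_instanceD[OF assms(1,2)]) auto

lemma expect_const:
  assumes "valid_instance C I" "b \<in> set I"
  shows "expect b (\<lambda>x p. c) = c"
proof -
  have "sum_list (map snd b) = 1"
    using assms by (auto simp: valid_instance_def pmf_of_list_wf_def)
  then have "(\<Sum>q<length b. snd (b ! q)) = 1"
    by (simp add: sum_list_sum_nth atLeast0LessThan)
  then show ?thesis
    by (simp add: expect_def flip: sum_distrib_right)
qed

lemma expect_nonneg:
  assumes "valid_instance C I" "b \<in> set I"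
    and "\<And>x p. 0 \<le> x \<Longrightarrow> x \<le> C \<Longrightarrow> 0 \<le> p \<Longrightarrow> 0 \<le> g x p"
  shows "0 \<le> expect b g"
  using expect_mono[OF assms(1,2), of "\<lambda>x p. 0" g] assms(3) expect_const[OF assms(1,2)] by simp

text \<open>The list may name an outcome several times or with weight 0. The mass of
  \<open>z\<close> is the sum of the weights at all positions carrying \<open>z\<close>; exchanging
  the two sums leaves a sum over positions.\<close>

lemma nn_integral_pmf_of_list:
  assumes "pmf_of_list_wf b"
  shows "(\<integral>\<^sup>+ z. g z \<partial>measure_pmf (pmf_of_list b)) =
    (\<Sum>q<length b. ennreal (snd (b ! q)) * g (fst (b ! q)))"
proof -
  let ?S = "set (map fst b)"
  have "(\<integral>\<^sup>+ z. g z \<partial>measure_pmf (pmf_of_list b)) =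
      (\<Sum>z\<in>?S. g z * ennreal (pmf (pmf_of_list b) z))"
    using set_pmf_of_list[OF assms] by (intro nn_integral_measure_pmf_support) auto
  also have "\<dots> = (\<Sum>z\<in>?S. \<Sum>q<length b. if fst (b ! q) = z then g z * ennreal (snd (b ! q)) else 0)"
  proof (rule sum.cong[OF refl])
    fix z
    have "pmf (pmf_of_list b) z = (\<Sum>q<length b. if fst (b ! q) = z then snd (b ! q) else 0)"
      unfolding pmf_pmf_of_list[OF assms] sum_list_map_filter'
      by (simp add: sum_list_sum_nth atLeast0LessThan)
    moreover have "0 \<le> snd (b ! q)" if "q < length b" for q
      using assms that by (auto simp: pmf_of_list_wf_def)
    ultimately have "ennreal (pmf (pmf_of_list b) z) =
        (\<Sum>q<length b. ennreal (if fst (b ! q) = z then snd (b ! q) else 0))"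
      by (simp only:) (subst sum_ennreal, auto)
    then show "g z * ennreal (pmf (pmf_of_list b) z) =
        (\<Sum>q<length b. if fst (b ! q) = z then g z * ennreal (snd (b ! q)) else 0)"
      by (auto simp: sum_distrib_left intro!: sum.cong)
  qed
  also have "\<dots> = (\<Sum>q<length b. \<Sum>z\<in>?S. if fst (b ! q) = z then g z * ennreal (snd (b ! q)) else 0)"
    by (rule sum.swap)
  also have "\<dots> = (\<Sum>q<length b. ennreal (snd (b ! q)) * g (fst (b ! q)))"
    by (intro sum.cong refl) (simp add: sum.delta' mult.commute)
  finally show ?thesis .
qed

lemma nn_integral_eq_expect:
  assumes "valid_instance C I" "b \<in> set I"
    and "\<And>x p. 0 \<le> x \<Longrightarrow> x \<le> C \<Longrightarrow> 0 \<le> p \<Longrightarrow> 0 \<le> g x p"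
  shows "(\<integral>\<^sup>+ z. ennreal (g (fst z) (snd z)) \<partial>measure_pmf (pmf_of_list b)) = ennreal (expect b g)"
proof -
  have wf: "pmf_of_list_wf b"
    using assms by (auto simp: valid_instance_def)
  note v = valid_instanceD[OF assms(1,2)]
  show ?thesis
    unfolding nn_integral_pmf_of_list[OF wf] expect_def
    by (subst sum_ennreal[symmetric])
      (auto simp: v intro!: mult_nonneg_nonneg assms(3) sum.cong ennreal_mult[symmetric])
qed


subsection \<open>Values of a policy and optimal values\<close>

primrec value_from :: "item_type list \<Rightarrow> real \<Rightarrow> policy \<Rightarrow> nat \<Rightarrow> history \<Rightarrow> real" where
  "value_from I cap \<pi> 0 h = 0"
| "value_from I cap \<pi> (Suc k) h = expect (I ! \<pi> h) (\<lambda>x p.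
     if total_size h + x \<le> cap then p + value_from I cap \<pi> k (h @ [(x, p)]) else 0)"

lemma value_from_nonneg:
  assumes "valid_instance C I" "\<pi> \<in> policies I"
  shows "0 \<le> value_from I cap \<pi> k h"
proof (induction k arbitrary: h)
  case (Suc k)
  have "I ! \<pi> h \<in> set I"
    using assms by (auto simp: policies_def)
  then show ?case
    using Suc by (auto intro!: expect_nonneg[OF assms(1)])
qed simp

definition valid_outcomes :: "real \<Rightarrow> history \<Rightarrow> bool" where
  "valid_outcomes C h \<longleftrightarrow> (\<forall>(x, p)\<in>set h. 0 \<le> x \<and> x \<le> C \<and> 0 \<le> p)"

lemma total_profit_nonneg: "valid_outcomes C h \<Longrightarrow> 0 \<le> total_profit h"
  by (auto simp: valid_outcomes_def total_profit_def intro!: sum_list_nonneg)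

lemma set_pmf_of_list_valid:
  assumes "valid_instance C I" "b \<in> set I" "z \<in> set_pmf (pmf_of_list b)"
  shows "0 \<le> fst z \<and> fst z \<le> C \<and> 0 \<le> snd z"
proof -
  have "pmf_of_list_wf b"
    using assms by (auto simp: valid_instance_def)
  then have "z \<in> fst ` set b"
    using set_pmf_of_list assms(3) by fastforce
  then obtain q where "q < length b" "z = fst (b ! q)"
    by (metis imageE in_set_conv_nth)
  then show ?thesis
    using valid_instanceD[OF assms(1,2)] by auto
qed

text \<open>Nonnegative profits along the run keep \<open>ennreal\<close> from truncating in the
  integrals below.\<close>

lemma run_valid_outcomes:
  assumes "valid_instance C I" "\<pi> \<in> policies I" "z \<in> set_pmf (run I cap \<pi> k)"
  shows "valid_outcomes C (fst z)"
  using assms(3)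
proof (induction k arbitrary: z)
  case (Suc k)
  have "I ! \<pi> h \<in> set I" for h
    using assms by (auto simp: policies_def)
  note * = set_pmf_of_list_valid[OF assms(1) this]
  show ?case
    using Suc.prems by (fastforce simp: valid_outcomes_def split: if_splits dest!: Suc.IH dest: *)
qed (simp add: valid_outcomes_def)

text \<open>Collected profit plus expected future profit has constant mean. The free
  \<open>m\<close> lets the induction convert one round of the forward process \<open>run\<close>
  into one round of the backward recursion \<open>value_from\<close>.\<close>

lemma nn_integral_run:
  assumes "valid_instance C I" "\<pi> \<in> policies I"
  shows "(\<integral>\<^sup>+ z. ennreal (total_profit (fst z) + (if snd z then 0 else value_from I cap \<pi> m (fst z)))
    \<partial>measure_pmf (run I cap \<pi> k)) = ennreal (value_from I cap \<pi> (k + m) [])"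
proof (induction k arbitrary: m)
  case 0
  show ?case
    by (simp add: total_profit_def)
next
  case (Suc k)
  let ?V = "value_from I cap \<pi>"
  let ?f = "\<lambda>m z. ennreal (total_profit (fst z) + (if snd z then 0 else ?V m (fst z)))"
  have step: "(\<integral>\<^sup>+ z. ?f m z \<partial>measure_pmf (case z of (h, stopped) \<Rightarrow>
       if stopped then return_pmf (h, True)
       else bind_pmf (pmf_of_list (I ! \<pi> h)) (\<lambda>(x, p).
         if total_size h + x \<le> cap then return_pmf (h @ [(x, p)], False)
         else return_pmf (h, True)))) = ?f (Suc m) z" (is "?L z = _")
    if "z \<in> set_pmf (run I cap \<pi> k)" for z
  proof (cases "snd z")
    case True
    then show ?thesis by (auto split: prod.splits)
  next
    case False
    define h where "h = fst z"
    have z: "z = (h, False)"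
      using False by (auto simp: h_def prod_eq_iff)
    have h: "0 \<le> total_profit h"
      using run_valid_outcomes[OF assms that] total_profit_nonneg by (simp add: h_def)
    have b: "I ! \<pi> h \<in> set I"
      using assms by (auto simp: policies_def)
    let ?g = "\<lambda>x p. total_profit h + (if total_size h + x \<le> cap then p + ?V m (h @ [(x, p)]) else 0)"
    have "?L z = (\<integral>\<^sup>+ z. ennreal (?g (fst z) (snd z)) \<partial>measure_pmf (pmf_of_list (I ! \<pi> h)))"
      unfolding z by (auto simp: total_profit_def algebra_simps split: prod.splits intro!: nn_integral_cong)
    also have "\<dots> = ennreal (expect (I ! \<pi> h) ?g)"
      using h value_from_nonneg[OF assms] by (intro nn_integral_eq_expect[OF assms(1) b]) auto
    also have "\<dots> = ?f (Suc m) z"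
      by (simp add: z expect_add expect_const[OF assms(1) b])
    finally show ?thesis .
  qed
  have "(\<integral>\<^sup>+ z. ?f m z \<partial>measure_pmf (run I cap \<pi> (Suc k))) =
      (\<integral>\<^sup>+ z. ?f (Suc m) z \<partial>measure_pmf (run I cap \<pi> k))"
    by (simp only: run.simps nn_integral_bind_pmf)
      (intro nn_integral_cong_AE, simp only: AE_measure_pmf_iff, use step in blast)
  then show ?case
    using Suc[of "Suc m"] by simp
qed

lemma policy_value_eq:
  assumes "valid_instance C I" "\<pi> \<in> policies I"
  shows "policy_value I cap \<pi> = (SUP k. ennreal (value_from I cap \<pi> k []))"
proof -
  have "(\<integral>\<^sup>+ z. ennreal (total_profit (fst z)) \<partial>measure_pmf (run I cap \<pi> k)) =
      ennreal (value_from I cap \<pi> k [])" for k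
    using nn_integral_run[OF assms, of cap k 0] by (simp cong: if_cong)
  then show ?thesis
    by (simp add: policy_value_def)
qed

section \<open>Finite-horizon dynamic programming as an upper bound for the optimum\<close>

primrec opt_value :: "item_type list \<Rightarrow> nat \<Rightarrow> real \<Rightarrow> real" where
  "opt_value I 0 c = 0"
| "opt_value I (Suc k) c = Max ((\<lambda>b. expect b (\<lambda>x p. if x \<le> c then p + opt_value I k (c - x) else 0)) ` set I)"

lemma expect_le_opt_value:
  assumes "b \<in> set I"
  shows "expect b (\<lambda>x p. if x \<le> c then p + opt_value I k (c - x) else 0) \<le> opt_value I (Suc k) c"
  using assms by simp

lemma opt_value_attained:
  assumes "valid_instance C I"
  obtains b where "b \<in> set I"
    "opt_value I (Suc k) c = expect b (\<lambda>x p. if x \<le> c then p + opt_value I k (c - x) else 0)"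
proof -
  have "opt_value I (Suc k) c \<in> (\<lambda>b. expect b (\<lambda>x p. if x \<le> c then p + opt_value I k (c - x) else 0)) ` set I"
    unfolding opt_value.simps using assms by (intro Max_in) (auto simp: valid_instance_def)
  then show ?thesis using that by blast
qed

lemma opt_value_nonneg:
  assumes "valid_instance C I"
  shows "0 \<le> opt_value I k c"
proof (induction k arbitrary: c)
  case (Suc k)
  obtain b where b: "b \<in> set I"
      "opt_value I (Suc k) c = expect b (\<lambda>x p. if x \<le> c then p + opt_value I k (c - x) else 0)"
    by (rule opt_value_attained[OF assms])
  show ?case
    unfolding b(2) using Suc by (intro expect_nonneg[OF assms b(1)]) auto
qed simp

lemma opt_value_mono:
  assumes "valid_instance C I" "c \<le> c'"
  shows "opt_value I k c \<le> opt_value I k c'"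
  using assms(2)
proof (induction k arbitrary: c c')
  case (Suc k)
  obtain b where b: "b \<in> set I"
      "opt_value I (Suc k) c = expect b (\<lambda>x p. if x \<le> c then p + opt_value I k (c - x) else 0)"
    by (rule opt_value_attained[OF assms(1)])
  have "opt_value I (Suc k) c \<le> expect b (\<lambda>x p. if x \<le> c' then p + opt_value I k (c' - x) else 0)"
    unfolding b(2) using Suc opt_value_nonneg[OF assms(1)]
    by (intro expect_mono[OF assms(1) b(1)]) auto
  then show ?case
    using expect_le_opt_value[OF b(1)] by (rule order_trans)
qed simp

lemma opt_value_Suc_ge:
  assumes "valid_instance C I"
  shows "opt_value I k c \<le> opt_value I (Suc k) c"
proof (induction k arbitrary: c)
  case 0
  show ?case
    using opt_value_nonneg[OF assms, of "Suc 0" c] by simp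
next
  case (Suc k)
  obtain b where b: "b \<in> set I"
      "opt_value I (Suc k) c = expect b (\<lambda>x p. if x \<le> c then p + opt_value I k (c - x) else 0)"
    by (rule opt_value_attained[OF assms(1)])
  have "opt_value I (Suc k) c \<le> expect b (\<lambda>x p. if x \<le> c then p + opt_value I (Suc k) (c - x) else 0)"
    unfolding b(2) using Suc
    by (intro expect_mono[OF assms(1) b(1)]) (auto simp del: opt_value.simps)
  then show ?case
    using expect_le_opt_value[OF b(1)] by (rule order_trans)
qed

lemma opt_value_le_top:
  assumes "valid_instance C I" "k \<le> k'" "c \<le> c'"
  shows "opt_value I k c \<le> opt_value I k' c'"
  using lift_Suc_mono_le[of "\<lambda>k. opt_value I k c", OF opt_value_Suc_ge[OF assms(1)] assms(2)]
    opt_value_mono[OF assms(1,3)] by (rule order_trans)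

text \<open>The past influences the future only through the used capacity, so a recursion on the
  remaining capacity dominates every history-dependent policy.\<close>

lemma value_from_le_opt_value:
  assumes "valid_instance C I" "\<pi> \<in> policies I"
  shows "value_from I cap \<pi> k h \<le> opt_value I k (cap - total_size h)"
proof (induction k arbitrary: h)
  case (Suc k)
  have b: "I ! \<pi> h \<in> set I"
    using assms by (auto simp: policies_def)
  have "value_from I cap \<pi> (Suc k) h \<le> expect (I ! \<pi> h)
      (\<lambda>x p. if x \<le> cap - total_size h then p + opt_value I k (cap - total_size h - x) else 0)"
    unfolding value_from.simps
  proof (intro expect_mono[OF assms(1) b])
    fix x p :: real
    have "total_size (h @ [(x, p)]) = total_size h + x"
      by (simp add: total_size_def)
    then show "(if total_size h + x \<le> cap then p + value_from I cap \<pi> k (h @ [(x, p)]) else 0)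
      \<le> (if x \<le> cap - total_size h then p + opt_value I k (cap - total_size h - x) else 0)"
      using Suc[of "h @ [(x, p)]"] by (auto simp: algebra_simps)
  qed
  then show ?case
    using expect_le_opt_value[OF b] by (rule order_trans)
qed simp

lemma OPT_le:
  assumes "valid_instance C I"
  shows "OPT I cap \<le> (SUP k. ennreal (opt_value I k cap))"
  unfolding OPT_def
proof (rule SUP_least)
  fix \<pi> assume "\<pi> \<in> policies I"
  note v = value_from_le_opt_value[OF assms this, of cap _ "[]"] policy_value_eq[OF assms this]
  show "policy_value I cap \<pi> \<le> (SUP k. ennreal (opt_value I k cap))"
    unfolding v(2) using v(1) by (intro SUP_mono) (auto simp: total_size_def intro!: ennreal_leI)
qed


subsection \<open>Unbiased rounding of the sizes to a grid\<close>

text \<open>The cap \<open>J\<close> bounds the counting loop by which the machine, having no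
  rounding, computes the level. Sizes in \<open>[0, C]\<close> stay below it when
  \<open>C < J \<delta>\<close>, so there the level is the floor.\<close>

definition level :: "nat \<Rightarrow> real \<Rightarrow> real \<Rightarrow> nat" where
  "level J \<delta> x = min J (nat \<lfloor>x / \<delta>\<rfloor>)"

definition rest :: "nat \<Rightarrow> real \<Rightarrow> real \<Rightarrow> real" where
  "rest J \<delta> x = x / \<delta> - real (level J \<delta> x)"

text \<open>The probability that the rounded size is nonzero, that is, that the process does not
  stay at its grid point.\<close>

definition turn :: "nat \<Rightarrow> real \<Rightarrow> item_type \<Rightarrow> real" where
  "turn J \<delta> b = expect b (\<lambda>x p. if level J \<delta> x = 0 then rest J \<delta> x else 1)"

text \<open>At level 0, rounding down keeps \<open>j\<close> with probability \<open>1 - f\<close>;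
  that share of \<open>v j\<close> is left out here and moved to the other side of the Bellman
  equation. The test \<open>k < j\<close> ensures that rounding up still fits.\<close>

definition gain :: "nat \<Rightarrow> real \<Rightarrow> (nat \<Rightarrow> real) \<Rightarrow> nat \<Rightarrow> real \<Rightarrow> real \<Rightarrow> real" where
  "gain J \<delta> v j x p = (let k = level J \<delta> x; f = rest J \<delta> x in
     if k < j then p + (if k = 0 then 0 else (1 - f) * v (j - k)) + f * v (j - k - 1) else 0)"

definition full_gain :: "nat \<Rightarrow> real \<Rightarrow> (nat \<Rightarrow> real) \<Rightarrow> nat \<Rightarrow> real \<Rightarrow> real \<Rightarrow> real" where
  "full_gain J \<delta> v j x p = (let k = level J \<delta> x; f = rest J \<delta> x in
     if k < j then p + (1 - f) * v (j - k) + f * v (j - k - 1) else 0)"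

text \<open>The Bellman equation cleared of the division by \<open>turn\<close>, relative to a set
  \<open>B\<close> of examined types so that it can serve as a loop invariant. The guard
  \<open>0 < u\<close> lets a scan start from \<open>u = 0\<close> with any valid index.\<close>

definition optimal_choice ::
  "nat \<Rightarrow> real \<Rightarrow> item_type list \<Rightarrow> (nat \<Rightarrow> real) \<Rightarrow> nat \<Rightarrow> item_type set \<Rightarrow> real \<Rightarrow> nat \<Rightarrow> bool" where
  "optimal_choice J \<delta> I v j B u i \<longleftrightarrow> 0 \<le> u \<and> i < length I \<and>
     (\<forall>b\<in>B. 0 < turn J \<delta> b \<longrightarrow> expect b (gain J \<delta> v j) \<le> u * turn J \<delta> b) \<and>
     (0 < u \<longrightarrow> 0 < turn J \<delta> (I ! i) \<and> expect (I ! i) (gain J \<delta> v j) = u * turn J \<delta> (I ! i))"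

text \<open>\<open>s\<close> is the intended excess of the true over the rounded capacity:
  \<open>-a\<close> when rounded policies imitate the optimum, \<open>a\<close> when the real policy
  imitates a rounded one.\<close>

definition dev :: "real \<Rightarrow> real \<Rightarrow> real \<Rightarrow> nat \<Rightarrow> real" where
  "dev \<delta> s c j = (c - real j * \<delta> - s)\<^sup>2 + \<delta> * c"

text \<open>Rounding is unbiased, and its variance \<open>f (1 - f) \<delta>\<^sup>2\<close> is paid for by the decrease of \<open>\<delta> c\<close>.\<close>

lemma dev_average_le:
  assumes "0 \<le> f" "f \<le> 1" "k < j" "x = (real k + f) * \<delta>" "0 < \<delta>"
  shows "(1 - f) * dev \<delta> s (c - x) (j - k) + f * dev \<delta> s (c - x) (j - k - 1) \<le> dev \<delta> s c j"
proof -
  define D where "D = c - real j * \<delta> - s"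
  have 1: "c - x - real (j - k) * \<delta> - s = D - f * \<delta>"
    using assms by (simp add: D_def of_nat_diff algebra_simps)
  have 2: "c - x - real (j - k - 1) * \<delta> - s = D + (1 - f) * \<delta>"
    using assms by (simp add: D_def of_nat_diff algebra_simps)
  have "(1 - f) * dev \<delta> s (c - x) (j - k) + f * dev \<delta> s (c - x) (j - k - 1) =
      D\<^sup>2 + f * (1 - f) * \<delta>\<^sup>2 + \<delta> * c - \<delta> * x"
    unfolding dev_def 1 2 by (simp add: power2_eq_square algebra_simps)
  also have "f * (1 - f) * \<delta>\<^sup>2 \<le> f * \<delta>\<^sup>2"
    using assms by (intro mult_right_mono) (auto simp: mult_left_le)
  also have "f * \<delta>\<^sup>2 \<le> \<delta> * x"
    using assms by (auto simp: power2_eq_square algebra_simps)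
  finally show ?thesis
    by (simp add: dev_def D_def)
qed

lemma dev_nonneg: "0 \<le> \<delta> \<Longrightarrow> 0 \<le> c \<Longrightarrow> 0 \<le> dev \<delta> s c j"
  by (simp add: dev_def)

text \<open>Turns "size 0 almost surely" into a literal argument 0, so that size tests and levels
  simplify.\<close>

lemma expect_no_size:
  assumes "\<And>q. q < length b \<Longrightarrow> snd (b ! q) = 0 \<or> fst (fst (b ! q)) = 0"
  shows "expect b g = expect b (\<lambda>x p. g 0 p)"
  unfolding expect_def using assms by (intro sum.cong refl) fastforce

lemma expect_zero_imp:
  assumes "valid_instance C I" "b \<in> set I" "expect b g = 0" "q < length b"
    and "\<And>x p. 0 \<le> x \<Longrightarrow> x \<le> C \<Longrightarrow> 0 \<le> g x p"
  shows "snd (b ! q) = 0 \<or> g (fst (fst (b ! q))) (snd (fst (b ! q))) = 0"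
proof -
  have "\<forall>q\<in>{..<length b}. snd (b ! q) * g (fst (fst (b ! q))) (snd (fst (b ! q))) = 0"
    using assms(3) unfolding expect_def
    by (subst (asm) sum_nonneg_eq_0_iff) (auto intro!: mult_nonneg_nonneg assms(5) valid_instanceD[OF assms(1,2)])
  then show ?thesis
    using assms(4) by auto
qed

locale grid =
  fixes C \<delta> :: real and J :: nat and I :: "item_type list"
  assumes C: "0 \<le> C" and \<delta>: "0 < \<delta>" and C_less: "C < real J * \<delta>" and valid: "valid_instance C I"
begin

lemma level_rest:
  assumes "0 \<le> x" "x \<le> C"
  shows "x = (real (level J \<delta> x) + rest J \<delta> x) * \<delta>" "0 \<le> rest J \<delta> x" "rest J \<delta> x \<le> 1"
proof -
  have "x / \<delta> < real J"
    using assms C_less \<delta> by (simp add: divide_simps)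
  then have "\<lfloor>x / \<delta>\<rfloor> \<le> int J"
    by linarith
  then have l: "level J \<delta> x = nat \<lfloor>x / \<delta>\<rfloor>"
    by (simp add: level_def)
  have "real (level J \<delta> x) = of_int \<lfloor>x / \<delta>\<rfloor>"
    unfolding l using assms \<delta> by simp
  then show "0 \<le> rest J \<delta> x" "rest J \<delta> x \<le> 1"
    unfolding rest_def by linarith+
  show "x = (real (level J \<delta> x) + rest J \<delta> x) * \<delta>"
    using \<delta> by (simp add: rest_def)
qed

lemma turn_eq_0_imp:
  assumes "b \<in> set I" "turn J \<delta> b = 0" "q < length b"
  shows "snd (b ! q) = 0 \<or> fst (fst (b ! q)) = 0"
proof -
  let ?x = "fst (fst (b ! q))"
  have "snd (b ! q) = 0 \<or> (if level J \<delta> ?x = 0 then rest J \<delta> ?x else 1) = 0"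
    using level_rest(2) assms(2)
    by (intro expect_zero_imp[OF valid assms(1) _ assms(3)]) (auto simp: turn_def)
  moreover have "?x = (real (level J \<delta> ?x) + rest J \<delta> ?x) * \<delta>"
    using valid_instanceD[OF valid assms(1,3)] by (intro level_rest(1))
  ultimately show ?thesis
    by (auto split: if_splits)
qed

lemma turn_nonneg: "b \<in> set I \<Longrightarrow> 0 \<le> turn J \<delta> b"
  unfolding turn_def using level_rest(2) by (intro expect_nonneg[OF valid]) auto

lemma expected_size_pos:
  assumes "b \<in> set I" "0 < turn J \<delta> b"
  shows "0 < expect b (\<lambda>x p. x)"
proof (rule ccontr)
  assume "\<not> ?thesis"
  moreover have "0 \<le> expect b (\<lambda>x p. x)"
    by (intro expect_nonneg[OF valid assms(1)])
  ultimately have "expect b (\<lambda>x p. x) = 0"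
    by simp
  then have "snd (b ! q) = 0 \<or> fst (fst (b ! q)) = 0" if "q < length b" for q
    using expect_zero_imp[OF valid assms(1), of "\<lambda>x p. x"] that by blast
  then have "turn J \<delta> b = expect b (\<lambda>x p. if level J \<delta> 0 = 0 then rest J \<delta> 0 else 1)"
    unfolding turn_def by (rule expect_no_size)
  also have "\<dots> = expect b (\<lambda>x p. 0)"
    by (simp add: level_def rest_def cong: if_cong)
  also have "\<dots> = 0"
    by (simp add: expect_def)
  finally show False
    using assms(2) by simp
qed

lemma expected_size_bound:
  obtains \<eta> where "0 < \<eta>" "\<And>b. b \<in> set I \<Longrightarrow> 0 < turn J \<delta> b \<Longrightarrow> \<eta> \<le> expect b (\<lambda>x p. x)"
proof -
  \<comment> \<open>The extra 1 keeps the set nonempty when every type has size 0 almost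
    surely.\<close>
  let ?S = "insert 1 ((\<lambda>b. expect b (\<lambda>x p. x)) ` {b \<in> set I. 0 < turn J \<delta> b})"
  show ?thesis
  proof
    show "0 < Min ?S"
      using expected_size_pos by (subst Min_gr_iff) auto
    show "Min ?S \<le> expect b (\<lambda>x p. x)" if "b \<in> set I" "0 < turn J \<delta> b" for b
      using that by (intro Min_le) auto
  qed
qed

lemma expect_gain_free:
  assumes "b \<in> set I" "turn J \<delta> b = 0" "0 < j"
  shows "expect b (gain J \<delta> v j) = expect b (\<lambda>x p. p)"
proof -
  have *: "snd (b ! q) = 0 \<or> fst (fst (b ! q)) = 0" if "q < length b" for q
    using turn_eq_0_imp assms that by blast
  have "expect b (gain J \<delta> v j) = expect b (\<lambda>x p. gain J \<delta> v j 0 p)"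
    using * by (rule expect_no_size)
  then show ?thesis
    using assms(3) by (simp add: gain_def level_def rest_def)
qed

lemma value_from_free:
  assumes "b \<in> set I" "turn J \<delta> b = 0" "i < length I" "I ! i = b" "total_size h \<le> cap"
  shows "value_from I cap (\<lambda>h. i) k h = real k * expect b (\<lambda>x p. p)"
  using assms(5)
proof (induction k arbitrary: h)
  case (Suc k)
  have *: "snd (b ! q) = 0 \<or> fst (fst (b ! q)) = 0" if "q < length b" for q
    using turn_eq_0_imp assms that by blast
  \<comment> \<open>With the literal size 0 the used size stays at most \<open>cap\<close>, as the
    induction hypothesis requires.\<close>
  have "value_from I cap (\<lambda>h. i) (Suc k) h = expect b (\<lambda>x p.
      if total_size h + 0 \<le> cap then p + value_from I cap (\<lambda>h. i) k (h @ [(0, p)]) else 0)"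
    using * by (simp only: value_from.simps assms(4)) (rule expect_no_size)
  also have "\<dots> = expect b (\<lambda>x p. p + real k * expect b (\<lambda>x p. p))"
    using Suc.prems by (subst Suc.IH) (auto simp: total_size_def)
  also have "\<dots> = real (Suc k) * expect b (\<lambda>x p. p)"
    by (simp add: expect_add expect_const[OF valid assms(1)] algebra_simps)
  finally show ?case .
qed simp

lemma policy_value_free:
  assumes "b \<in> set I" "turn J \<delta> b = 0" "i < length I" "I ! i = b" "0 < expect b (\<lambda>x p. p)" "0 \<le> cap"
  shows "policy_value I cap (\<lambda>h. i) = \<infinity>"
proof -
  have "policy_value I cap (\<lambda>h. i) = (SUP k. ennreal (real k * expect b (\<lambda>x p. p)))"
    using assms value_from_free[OF assms(1-4), of "[]" cap]
    by (subst policy_value_eq[OF valid]) (auto simp: policies_def total_size_def)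
  also have "\<dots> = (SUP k. of_nat k * ennreal (expect b (\<lambda>x p. p)))"
    using assms(5) by (simp add: ennreal_mult ennreal_of_nat_eq_real_of_nat)
  also have "\<dots> = (SUP k. of_nat k) * ennreal (expect b (\<lambda>x p. p))"
    by (simp add: SUP_mult_right_ennreal)
  also have "\<dots> = \<infinity>"
    using assms(5) by (simp add: ennreal_SUP_of_nat_eq_top ennreal_top_mult)
  finally show ?thesis .
qed

end

text \<open>What planning delivers unless a profitable type of size 0 exists. \<open>no_free\<close>
  covers the types with \<open>turn\<close> 0, which \<open>optimal_choice\<close> leaves
  unconstrained.\<close>

locale grid_solution = grid +
  fixes v :: "nat \<Rightarrow> real" and best :: "nat \<Rightarrow> nat"
  assumes v_0: "v 0 = 0"
    and optimal: "\<And>j. 0 < j \<Longrightarrow> j \<le> J \<Longrightarrow> optimal_choice J \<delta> I v j (set I) (v j) (best j)"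
    and no_free: "\<And>b. b \<in> set I \<Longrightarrow> turn J \<delta> b = 0 \<Longrightarrow> expect b (\<lambda>x p. p) \<le> 0"
begin

lemma v_nonneg: "j \<le> J \<Longrightarrow> 0 \<le> v j"
  using optimal[of j] v_0 by (cases "j = 0") (auto simp: optimal_choice_def)

lemma full_gain_nonneg:
  assumes "0 \<le> x" "x \<le> C" "0 \<le> p" "j \<le> J"
  shows "0 \<le> full_gain J \<delta> v j x p"
  using assms level_rest[OF assms(1,2)] v_nonneg
  by (auto simp: full_gain_def Let_def intro!: add_nonneg_nonneg mult_nonneg_nonneg)

text \<open>Restores the self-loop: the two gains differ pointwise by the share of
  \<open>v j\<close> that stays at \<open>j\<close>. At levels from \<open>j\<close> on both vanish,
  and the factor of \<open>v j\<close> is 1 since \<open>0 < j\<close>.\<close>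

lemma expect_full_gain:
  assumes "b \<in> set I" "0 < j"
  shows "expect b (gain J \<delta> v j) + v j = expect b (full_gain J \<delta> v j) + v j * turn J \<delta> b"
proof -
  have *: "gain J \<delta> v j x p + v j =
      full_gain J \<delta> v j x p + v j * (if level J \<delta> x = 0 then rest J \<delta> x else 1)" for x p
    using assms by (simp add: gain_def full_gain_def Let_def algebra_simps)
  have "expect b (\<lambda>x p. gain J \<delta> v j x p + v j) = expect b (\<lambda>x p.
      full_gain J \<delta> v j x p + v j * (if level J \<delta> x = 0 then rest J \<delta> x else 1))"
    unfolding * ..
  then show ?thesis
    unfolding expect_add expect_cmult expect_const[OF valid assms(1)] turn_def .
qed

lemma expect_full_gain_le:
  assumes "b \<in> set I" "0 < j" "j \<le> J"
  shows "expect b (full_gain J \<delta> v j) \<le> v j"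
proof (cases "turn J \<delta> b = 0")
  case True
  then show ?thesis
    using expect_full_gain[OF assms(1,2)] expect_gain_free[OF assms(1) True assms(2), of v]
      no_free[OF assms(1) True] by simp
next
  case False
  then show ?thesis
    using expect_full_gain[OF assms(1,2)] optimal[OF assms(2,3)] turn_nonneg[OF assms(1)] assms(1)
    by (fastforce simp: optimal_choice_def)
qed

lemma expect_full_gain_best:
  assumes "0 < j" "j \<le> J" "0 < v j"
  shows "I ! best j \<in> set I" "0 < turn J \<delta> (I ! best j)"
    "expect (I ! best j) (full_gain J \<delta> v j) = v j"
proof -
  show b: "I ! best j \<in> set I" and "0 < turn J \<delta> (I ! best j)"
    using optimal[OF assms(1,2)] assms(3) by (auto simp: optimal_choice_def)
  show "expect (I ! best j) (full_gain J \<delta> v j) = v j"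
    using expect_full_gain[OF b assms(1)] optimal[OF assms(1,2)] assms(3)
    by (auto simp: optimal_choice_def)
qed

text \<open>The best type at \<open>j\<close> is tried at \<open>Suc j\<close>. Since
  \<open>gain\<close> refers to smaller grid points only, strong induction compares the two
  numerators over the same positive \<open>turn\<close>; with \<open>full_gain\<close> the self-loop
  would make this circular.\<close>

lemma v_Suc_ge: "Suc j \<le> J \<Longrightarrow> v j \<le> v (Suc j)"
proof (induction j rule: less_induct)
  case (less j)
  show ?case
  proof (cases "0 < v j")
    case False
    then show ?thesis
      using v_nonneg[of "Suc j"] less.prems by simp
  next
    case True
    have j: "0 < j"
      using True v_0 by (cases j) auto
    let ?b = "I ! best j"
    note best = expect_full_gain_best[OF j _ True]
    have b: "?b \<in> set I" "0 < turn J \<delta> ?b"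
      using best less.prems by auto
    have "v j * turn J \<delta> ?b = expect ?b (gain J \<delta> v j)"
      using optimal[of j] j less.prems True by (simp add: optimal_choice_def)
    also have "\<dots> \<le> expect ?b (gain J \<delta> v (Suc j))"
    proof (rule expect_mono[OF valid b(1)])
      fix x p :: real
      assume x: "0 \<le> x" "x \<le> C" and p: "0 \<le> p"
      let ?k = "level J \<delta> x"
      show "gain J \<delta> v j x p \<le> gain J \<delta> v (Suc j) x p"
      proof (cases "?k < j")
        case True
        have "v (j - ?k) \<le> v (Suc j - ?k)" if "?k \<noteq> 0"
          using less.IH[of "j - ?k"] that True less.prems by (simp add: Suc_diff_le)
        moreover have "v (j - ?k - 1) \<le> v (Suc j - ?k - 1)"
          using less.IH[of "j - ?k - 1"] True less.prems by (simp add: Suc_diff_Suc)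
        ultimately show ?thesis
          using True level_rest[OF x] by (auto simp: gain_def Let_def intro!: add_mono mult_left_mono)
      next
        case False
        then show ?thesis
          using level_rest[OF x] p v_nonneg less.prems
          by (auto simp: gain_def Let_def intro!: add_nonneg_nonneg mult_nonneg_nonneg)
      qed
    qed
    also have "\<dots> \<le> v (Suc j) * turn J \<delta> ?b"
      using optimal[of "Suc j"] b less.prems by (simp add: optimal_choice_def)
    finally show ?thesis
      using b(2) by simp
  qed
qed

lemma v_le_top: "j \<le> J \<Longrightarrow> v j \<le> v J"
proof (induction rule: inc_induct)
  case (step j)
  then show ?case
    using v_Suc_ge[of j] by simp
qed simp

text \<open>The optimal policy for capacity \<open>c\<close> is simulated with the rounded capacity \<open>j \<delta>\<close>, which
  exceeds \<open>c\<close> by about \<open>a\<close>. Once the excess is used up the correction term is at least \<open>M\<close>.\<close>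

lemma opt_value_bound:
  assumes "0 < a" "0 \<le> M" "\<And>k c. k \<le> K \<Longrightarrow> c \<le> C \<Longrightarrow> opt_value I k c \<le> M"
    and "k \<le> K" "0 \<le> c" "c \<le> C" "j \<le> J"
  shows "opt_value I k c \<le> v j + M / a\<^sup>2 * dev \<delta> (-a) c j"
  using assms(4-)
proof (induction k arbitrary: c j)
  case 0
  then show ?case
    using v_nonneg dev_nonneg[of \<delta> c] \<delta> assms(1,2) by simp
next
  case (Suc k)
  define A where "A = M / a\<^sup>2"
  have A: "0 \<le> A"
    using assms(2) by (simp add: A_def)
  have "opt_value I (Suc k) c \<le> v j + A * dev \<delta> (-a) c j"
  proof (cases "real j * \<delta> \<le> c")
    case True
    have "a\<^sup>2 \<le> (c - real j * \<delta> + a)\<^sup>2"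
      using True assms(1) by (intro power_mono) auto
    also have "\<dots> \<le> dev \<delta> (-a) c j"
      using \<delta> Suc.prems by (simp add: dev_def)
    finally have "M \<le> A * dev \<delta> (-a) c j"
      using assms(1) mult_left_mono[OF _ A] by (fastforce simp: A_def)
    then show ?thesis
      using assms(3)[OF Suc.prems(1,3)] v_nonneg[OF Suc.prems(4)] by linarith
  next
    case False
    then have j: "0 < j"
      using Suc.prems by (cases j) auto
    obtain b where b: "b \<in> set I"
      "opt_value I (Suc k) c = expect b (\<lambda>x p. if x \<le> c then p + opt_value I k (c - x) else 0)"
      by (rule opt_value_attained[OF valid])
    have "opt_value I (Suc k) c \<le> expect b (\<lambda>x p. full_gain J \<delta> v j x p + A * dev \<delta> (-a) c j)"
      unfolding b(2)
    proof (rule expect_mono[OF valid b(1)])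
      fix x p :: real
      assume x: "0 \<le> x" "x \<le> C" and p: "0 \<le> p"
      show "(if x \<le> c then p + opt_value I k (c - x) else 0)
        \<le> full_gain J \<delta> v j x p + A * dev \<delta> (-a) c j"
      proof (cases "x \<le> c")
        case True
        define l where "l = level J \<delta> x"
        define f where "f = rest J \<delta> x"
        have lf: "x = (real l + f) * \<delta>" "0 \<le> f" "f \<le> 1"
          using level_rest[OF x] by (simp_all add: l_def f_def)
        \<comment> \<open>Because \<open>c < j \<delta>\<close>, a size that fits into
          \<open>c\<close> has level below \<open>j\<close>, so even rounding up stays on the
          grid.\<close>
        have "real l * \<delta> \<le> x"
          using lf \<delta> by (simp add: algebra_simps)
        also have "\<dots> < real j * \<delta>"
          using True False by simp
        finally have l: "l < j"
          using \<delta> by simp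
        have IH: "opt_value I k (c - x) \<le> v i + A * dev \<delta> (-a) (c - x) i" if "i \<le> J" for i
          using Suc.prems True x that unfolding A_def by (intro Suc.IH) auto
        \<comment> \<open>The true remainder \<open>c - x\<close> is the same for both roundings, so
          the induction hypothesis can be averaged over the two grid points.\<close>
        have "opt_value I k (c - x) =
            (1 - f) * opt_value I k (c - x) + f * opt_value I k (c - x)"
          by (simp add: algebra_simps)
        also have "\<dots> \<le> (1 - f) * (v (j - l) + A * dev \<delta> (-a) (c - x) (j - l))
            + f * (v (j - l - 1) + A * dev \<delta> (-a) (c - x) (j - l - 1))"
          using lf Suc.prems by (intro add_mono mult_left_mono IH) auto
        also have "\<dots> = (1 - f) * v (j - l) + f * v (j - l - 1) +
            A * ((1 - f) * dev \<delta> (-a) (c - x) (j - l) + f * dev \<delta> (-a) (c - x) (j - l - 1))"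
          by (simp add: algebra_simps)
        also have "\<dots> \<le> (1 - f) * v (j - l) + f * v (j - l - 1) + A * dev \<delta> (-a) c j"
          using dev_average_le[OF lf(2,3) l lf(1) \<delta>] A by (intro add_left_mono mult_left_mono)
        finally show ?thesis
          using True l by (simp add: full_gain_def flip: l_def f_def)
      next
        case False
        then show ?thesis
          using full_gain_nonneg[OF x p Suc.prems(4)] A dev_nonneg[of \<delta> c] \<delta> Suc.prems by simp
      qed
    qed
    also have "\<dots> \<le> v j + A * dev \<delta> (-a) c j"
      using expect_full_gain_le[OF b(1) j Suc.prems(4)]
      by (simp add: expect_add expect_const[OF valid b(1)])
    finally show ?thesis .
  qed
  then show ?case
    by (simp add: A_def)
qed

end


subsection \<open>The policy\<close>

text \<open>The state consists of the remaining capacity and of the rounded capacity, which is \<open>0\<close> when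
  the policy has given up. Instead of rounding at random, the policy rounds so as to maximize the
  potential that is used in the analysis.\<close>

definition potential :: "real \<Rightarrow> real \<Rightarrow> real \<Rightarrow> (nat \<Rightarrow> real) \<Rightarrow> real \<Rightarrow> nat \<Rightarrow> real" where
  "potential \<delta> a \<mu> v c m = v m - \<mu> * (c - real m * \<delta> - a)\<^sup>2"

definition next_state ::
  "nat \<Rightarrow> real \<Rightarrow> real \<Rightarrow> real \<Rightarrow> (nat \<Rightarrow> real) \<Rightarrow> real \<times> nat \<Rightarrow> outcome \<Rightarrow> real \<times> nat" where
  "next_state J \<delta> a \<mu> v s z = (let c = fst s - fst z; j = snd s; k = level J \<delta> (fst z) in
     (c, if k < j
         then if potential \<delta> a \<mu> v c (j - k - 1) < potential \<delta> a \<mu> v c (j - k) then j - k else j - k - 1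
         else 0))"

definition grid_policy ::
  "nat \<Rightarrow> real \<Rightarrow> real \<Rightarrow> real \<Rightarrow> (nat \<Rightarrow> real) \<Rightarrow> (nat \<Rightarrow> nat) \<Rightarrow> real \<times> nat \<Rightarrow> policy" where
  "grid_policy J \<delta> a \<mu> v best s h = best (snd (foldl (next_state J \<delta> a \<mu> v) s h))"

lemma fst_foldl_next_state: "fst (foldl (next_state J \<delta> a \<mu> v) s h) = fst s - total_size h"
  by (induction h rule: rev_induct) (auto simp: next_state_def Let_def total_size_def)

lemma snd_foldl_next_state: "snd (foldl (next_state J \<delta> a \<mu> v) s h) \<le> snd s"
  by (induction h rule: rev_induct) (auto simp: next_state_def Let_def)

text \<open>Grid point 0 is absorbing. Starting there is how a profitable type of size 0 is repeated
  forever.\<close>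

lemma grid_policy_dead: "grid_policy J \<delta> a \<mu> v best (c, 0) = (\<lambda>h. best 0)"
  using snd_foldl_next_state[of J \<delta> a \<mu> v "(c, 0)"] by (auto simp: grid_policy_def fun_eq_iff)

lemma grid_policy_in_policies:
  assumes "\<And>j. j \<le> snd s \<Longrightarrow> best j < length I"
  shows "grid_policy J \<delta> a \<mu> v best s \<in> policies I"
  using assms snd_foldl_next_state by (auto simp: policies_def grid_policy_def)

context grid_solution
begin

text \<open>Every round increases the lower bound by \<open>\<theta> \<eta>\<close>, because it uses expected size at least \<open>\<eta>\<close>;
  hence the bound is free of the term \<open>v J\<close> after finitely many rounds.\<close>

lemma value_from_ge:
  fixes a \<theta> \<eta> c\<^sub>0 :: real
  defines "\<mu> \<equiv> v J / a\<^sup>2"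
  assumes a: "0 < a" and \<theta>: "0 \<le> \<theta>" and \<eta>: "0 \<le> \<eta>"
    and \<eta>_le: "\<And>b. b \<in> set I \<Longrightarrow> 0 < turn J \<delta> b \<Longrightarrow> \<eta> \<le> expect b (\<lambda>x p. x)"
    and pol: "grid_policy J \<delta> a \<mu> v best (c\<^sub>0, J) \<in> policies I"
    and k: "real k * (\<theta> * \<eta>) \<le> v J"
    and st: "foldl (next_state J \<delta> a \<mu> v) (c\<^sub>0, J) h = (c, j)" and c: "0 \<le> c"
  shows "v j - \<mu> * dev \<delta> a c j - \<theta> * (c + C) - (v J - real k * (\<theta> * \<eta>))
    \<le> value_from I c\<^sub>0 (grid_policy J \<delta> a \<mu> v best (c\<^sub>0, J)) k h"
  using k st c
proof (induction k arbitrary: h c j)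
  case 0
  then have "j \<le> J"
    using snd_foldl_next_state[of J \<delta> a \<mu> v "(c\<^sub>0, J)" h] by simp
  moreover have "0 \<le> \<mu> * dev \<delta> a c j"
    using v_nonneg[of J] dev_nonneg[of \<delta> c] \<delta> 0 by (simp add: \<mu>_def)
  moreover have "0 \<le> \<theta> * (c + C)"
    using \<theta> C 0 by simp
  ultimately show ?case
    using v_le_top[of j] by simp
next
  case (Suc k)
  let ?\<pi> = "grid_policy J \<delta> a \<mu> v best (c\<^sub>0, J)"
  let ?V = "value_from I c\<^sub>0 ?\<pi>"
  have \<mu>: "0 \<le> \<mu>"
    using v_nonneg[of J] by (simp add: \<mu>_def)
  have j: "j \<le> J"
    using snd_foldl_next_state[of J \<delta> a \<mu> v "(c\<^sub>0, J)" h] Suc.prems by simp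
  have c_eq: "c = c\<^sub>0 - total_size h"
    using fst_foldl_next_state[of J \<delta> a \<mu> v "(c\<^sub>0, J)" h] Suc.prems by simp
  have dev: "0 \<le> dev \<delta> a c j"
    using dev_nonneg[of \<delta> c] \<delta> Suc.prems by simp
  have \<theta>\<eta>: "0 \<le> \<theta> * \<eta>"
    using \<theta> \<eta> by simp
  have k: "real k * (\<theta> * \<eta>) + \<theta> * \<eta> \<le> v J"
    using Suc.prems(1) by (simp add: algebra_simps)
  show ?case
  \<comment> \<open>While \<open>j \<delta> < c\<close>, every copy with level below
    \<open>j\<close> really fits, and \<open>0 < v j\<close> makes \<open>best j\<close> meaningful.
    In all other cases the lower bound is at most 0 and holds trivially.\<close>
  proof (cases "real j * \<delta> < c \<and> 0 < v j")
    case False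
    have "v j - \<mu> * dev \<delta> a c j \<le> 0"
    proof (cases "c \<le> real j * \<delta>")
      case True
      have "a\<^sup>2 \<le> (a + real j * \<delta> - c)\<^sup>2"
        using True a by (intro power_mono) auto
      also have "\<dots> = (c - real j * \<delta> - a)\<^sup>2"
        by (simp add: power2_eq_square algebra_simps)
      also have "\<dots> \<le> dev \<delta> a c j"
        using \<delta> Suc.prems by (simp add: dev_def)
      finally have "\<mu> * a\<^sup>2 \<le> \<mu> * dev \<delta> a c j"
        using \<mu> by (rule mult_left_mono)
      then show ?thesis
        using a v_le_top[OF j] by (simp add: \<mu>_def)
    next
      case False
      then have "v j \<le> 0"
        using \<open>\<not> (real j * \<delta> < c \<and> 0 < v j)\<close> by auto
      then show ?thesis
        using mult_nonneg_nonneg[OF \<mu> dev] by linarith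
    qed
    moreover have "0 \<le> \<theta> * (c + C)"
      using \<theta> C Suc.prems by simp
    moreover have "0 \<le> ?V (Suc k) h"
      by (rule value_from_nonneg[OF valid pol])
    ultimately show ?thesis
      using Suc.prems(1) by linarith
  next
    case True
    then have c_gt: "real j * \<delta> < c" and vj: "0 < v j"
      by auto
    have j0: "0 < j"
      using vj v_0 by (cases j) auto
    define b where "b = I ! best j"
    have b_eq: "I ! ?\<pi> h = b"
      using Suc.prems by (simp add: grid_policy_def b_def)
    note b = expect_full_gain_best[OF j0 j vj, folded b_def]
    define R where "R = v J - real k * (\<theta> * \<eta>)"
    have R: "0 \<le> R"
      using k \<theta>\<eta> by (simp add: R_def)
    have "expect b (\<lambda>x p. full_gain J \<delta> v j x p + (\<theta> * x + (- \<mu> * dev \<delta> a c j - \<theta> * (c + C) - R)))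
      \<le> ?V (Suc k) h"
      unfolding value_from.simps b_eq
    proof (rule expect_mono[OF valid b(1)])
      fix x p :: real
      assume x: "0 \<le> x" "x \<le> C" and p: "0 \<le> p"
      define l where "l = level J \<delta> x"
      define f where "f = rest J \<delta> x"
      have lf: "x = (real l + f) * \<delta>" "0 \<le> f" "f \<le> 1"
        using level_rest[OF x] by (simp_all add: l_def f_def)
      \<comment> \<open>An overflowing copy may push \<open>c - x\<close> below 0, but not below
        \<open>-C\<close>; hence the offset \<open>C\<close> in the \<open>\<theta>\<close>
        term.\<close>
      have \<theta>C: "0 \<le> \<theta> * (c - x + C)"
        using \<theta> x Suc.prems by simp
      show "full_gain J \<delta> v j x p + (\<theta> * x + (- \<mu> * dev \<delta> a c j - \<theta> * (c + C) - R))
        \<le> (if total_size h + x \<le> c\<^sub>0 then p + ?V k (h @ [(x, p)]) else 0)"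
      proof (cases "l < j")
        case True
        have "x \<le> (real l + 1) * \<delta>"
          unfolding lf(1) using lf \<delta> by (intro mult_right_mono) auto
        also have "\<dots> \<le> real j * \<delta>"
          using True \<delta> by (intro mult_right_mono) auto
        finally have xc: "x \<le> c"
          using c_gt by simp
        let ?P = "potential \<delta> a \<mu> v (c - x)"
        define m where "m = (if ?P (j - l - 1) < ?P (j - l) then j - l else j - l - 1)"
        have "foldl (next_state J \<delta> a \<mu> v) (c\<^sub>0, J) (h @ [(x, p)]) = (c - x, m)"
          unfolding foldl_append Suc.prems(2) using True by (simp add: next_state_def m_def l_def Let_def)
        then have IH: "v m - \<mu> * dev \<delta> a (c - x) m - \<theta> * (c - x + C) - R \<le> ?V k (h @ [(x, p)])"
          using xc k \<theta>\<eta> unfolding R_def by (intro Suc.IH) auto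
        \<comment> \<open>A maximum is at least every weighted average, so the derandomized rounding
          works without knowing \<open>f\<close>.\<close>
        have "?P m = (1 - f) * ?P m + f * ?P m"
          by (simp add: algebra_simps)
        also have "\<dots> \<ge> (1 - f) * ?P (j - l) + f * ?P (j - l - 1)"
          using lf by (intro add_mono mult_left_mono) (auto simp: m_def)
        \<comment> \<open>\<open>potential\<close> lacks the reserve \<open>\<delta> (c - x)\<close>
          of \<open>dev\<close>, which is the same at both grid points and cancels.\<close>
        finally have "(1 - f) * v (j - l) + f * v (j - l - 1) -
            \<mu> * ((1 - f) * dev \<delta> a (c - x) (j - l) + f * dev \<delta> a (c - x) (j - l - 1))
            \<le> v m - \<mu> * dev \<delta> a (c - x) m"
          by (simp add: potential_def dev_def algebra_simps)
        moreover have "\<mu> * ((1 - f) * dev \<delta> a (c - x) (j - l) + f * dev \<delta> a (c - x) (j - l - 1))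
            \<le> \<mu> * dev \<delta> a c j"
          using dev_average_le[OF lf(2,3) True lf(1) \<delta>] \<mu> by (rule mult_left_mono)
        moreover have "total_size h + x \<le> c\<^sub>0"
          using xc c_eq by simp
        ultimately show ?thesis
          using IH True by (simp add: full_gain_def algebra_simps flip: l_def f_def)
      next
        case False
        have "0 \<le> ?V k (h @ [(x, p)])"
          by (rule value_from_nonneg[OF valid pol])
        then show ?thesis
          using False p \<theta>C R mult_nonneg_nonneg[OF \<mu> dev]
          by (auto simp: full_gain_def algebra_simps simp flip: l_def)
      qed
    qed
    then have "v j + (\<theta> * expect b (\<lambda>x p. x) + (- \<mu> * dev \<delta> a c j - \<theta> * (c + C) - R)) \<le> ?V (Suc k) h"
      unfolding expect_add expect_const[OF valid b(1)] b(3) expect_cmult .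
    moreover have "\<theta> * \<eta> \<le> \<theta> * expect b (\<lambda>x p. x)"
      using \<eta>_le[OF b(1,2)] \<theta> by (rule mult_left_mono)
    ultimately show ?thesis
      by (simp add: R_def algebra_simps)
  qed
qed

text \<open>From capacity \<open>J \<delta> + a\<close> the squared deviation starts at 0, so
  \<open>dev\<close> is the reserve \<open>\<delta> c\<close> alone; this is the whole loss up to an
  arbitrarily small \<open>e\<close>.\<close>

lemma policy_value_ge:
  fixes a :: real
  defines "\<mu> \<equiv> v J / a\<^sup>2" and "c \<equiv> real J * \<delta> + a"
  assumes a: "0 < a" and pol: "grid_policy J \<delta> a \<mu> v best (c, J) \<in> policies I"
  shows "ennreal (v J * (1 - \<delta> * c / a\<^sup>2)) \<le> policy_value I c (grid_policy J \<delta> a \<mu> v best (c, J))"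
    (is "ennreal ?L \<le> ?S")
proof -
  obtain \<eta> where \<eta>: "0 < \<eta>" "\<And>b. b \<in> set I \<Longrightarrow> 0 < turn J \<delta> b \<Longrightarrow> \<eta> \<le> expect b (\<lambda>x p. x)"
    using expected_size_bound by blast
  have c: "0 < c"
    using a \<delta> C C_less by (simp add: c_def)
  have *: "ennreal (?L - e) \<le> ?S" if "0 < e" for e
  proof -
    \<comment> \<open>Chosen so that the initial \<open>\<theta>\<close> term and one round's
      progress \<open>\<theta> \<eta>\<close> add up to \<open>e\<close>.\<close>
    define \<theta> where "\<theta> = e / (c + C + \<eta>)"
    have pos: "0 < c + C + \<eta>"
      using c C \<eta> by simp
    then have \<theta>: "0 < \<theta>" and "\<theta> * (c + C + \<eta>) = e"
      using that by (simp_all add: \<theta>_def)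
    then have e: "\<theta> * (c + C) + \<theta> * \<eta> = e"
      by (simp add: algebra_simps)
    have \<theta>\<eta>: "0 < \<theta> * \<eta>"
      using \<theta> \<eta> by simp
    \<comment> \<open>As many rounds as \<open>value_from_ge\<close> permits; what remains of
      \<open>v J\<close> is at most \<open>\<theta> \<eta>\<close>.\<close>
    define k where "k = nat \<lfloor>v J / (\<theta> * \<eta>)\<rfloor>"
    have "real k = of_int \<lfloor>v J / (\<theta> * \<eta>)\<rfloor>"
      using v_nonneg[of J] \<theta>\<eta> by (simp add: k_def)
    then have "real k \<le> v J / (\<theta> * \<eta>)" "v J / (\<theta> * \<eta>) \<le> real k + 1"
      by linarith+
    then have k: "real k * (\<theta> * \<eta>) \<le> v J" "v J \<le> real k * (\<theta> * \<eta>) + \<theta> * \<eta>"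
      using \<theta>\<eta> by (simp_all add: pos_le_divide_eq pos_divide_le_eq algebra_simps)
    have "v J - \<mu> * dev \<delta> a c J - \<theta> * (c + C) - (v J - real k * (\<theta> * \<eta>))
      \<le> value_from I c (grid_policy J \<delta> a \<mu> v best (c, J)) k []"
      unfolding \<mu>_def using \<theta> \<eta> k c a pol
      by (intro value_from_ge) (auto simp: \<mu>_def)
    moreover have "\<mu> * dev \<delta> a c J = v J * (\<delta> * c / a\<^sup>2)"
      by (simp add: dev_def c_def \<mu>_def)
    ultimately have "?L - e \<le> value_from I c (grid_policy J \<delta> a \<mu> v best (c, J)) k []"
      using k(2) e by (simp add: algebra_simps)
    then show ?thesis
      unfolding policy_value_eq[OF valid pol] by (intro SUP_upper2[of k] ennreal_leI) auto
  qed
  show ?thesis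
  proof (cases ?S)
    case (real r)
    have "?L \<le> r + e" if "0 < e" for e
      using *[OF that] real by (cases "0 \<le> ?L - e") auto
    then have "?L \<le> r"
      by (rule field_le_epsilon)
    then show ?thesis
      using real by (simp add: ennreal_leI)
  qed simp
qed

text \<open>The uniform bound \<open>M\<close> of \<open>opt_value_bound\<close> is taken to be the
  very quantity estimated, so the error is a fraction \<open>\<kappa>\<close> of it and is absorbed
  on the left.\<close>

lemma opt_le:
  assumes "0 < a" "\<delta> * C \<le> \<kappa> * a\<^sup>2" "\<kappa> \<le> 1" "C + a = real J * \<delta>"
  shows "(1 - \<kappa>) * opt_value I K C \<le> v J"
proof -
  let ?M = "opt_value I K C"
  have M: "0 \<le> ?M"
    by (rule opt_value_nonneg[OF valid])
  have "?M \<le> v J + ?M / a\<^sup>2 * dev \<delta> (-a) C J"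
    using assms C M by (intro opt_value_bound[where K = K]) (auto intro: opt_value_le_top[OF valid])
  also have "dev \<delta> (-a) C J = \<delta> * C"
    by (simp add: dev_def flip: assms(4))
  also have "?M / a\<^sup>2 * (\<delta> * C) \<le> ?M / a\<^sup>2 * (\<kappa> * a\<^sup>2)"
    using assms M by (intro mult_left_mono) auto
  finally show ?thesis
    using assms(1) by (simp add: algebra_simps)
qed

end

subsection \<open>Reasoning about programs\<close>

definition ends :: "com \<Rightarrow> memory \<Rightarrow> nat \<Rightarrow> (memory \<Rightarrow> bool) \<Rightarrow> bool" where
  "ends c s T Q \<longleftrightarrow> (\<exists>t s'. exec c s t s' \<and> t \<le> T \<and> Q s')"

primrec loop_free :: "com \<Rightarrow> bool" where
  "loop_free Skip = True"
| "loop_free (NAssign a i e) = True"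
| "loop_free (RAssign a i e) = True"
| "loop_free (Seq c d) = (loop_free c \<and> loop_free d)"
| "loop_free (Cond b c d) = (loop_free c \<and> loop_free d)"
| "loop_free (While b c) = False"

text \<open>The clauses for \<open>While\<close> here and in \<open>cost\<close> are fillers; both
  functions describe \<open>loop_free\<close> programs.\<close>

primrec sem :: "com \<Rightarrow> memory \<Rightarrow> memory" where
  "sem Skip s = s"
| "sem (NAssign a i e) s = nat_update a (nval s i) (nval s e) s"
| "sem (RAssign a i e) s = real_update a (nval s i) (rval s e) s"
| "sem (Seq c d) s = sem d (sem c s)"
| "sem (Cond b c d) s = (if bval s b then sem c s else sem d s)"
| "sem (While b c) s = s"

primrec cost :: "com \<Rightarrow> nat" where
  "cost Skip = 1"
| "cost (NAssign a i e) = 1"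
| "cost (RAssign a i e) = 1"
| "cost (Seq c d) = cost c + cost d"
| "cost (Cond b c d) = max (cost c) (cost d) + 1"
| "cost (While b c) = 0"

lemma exec_sem: "loop_free c \<Longrightarrow> \<exists>t\<le>cost c. exec c s t (sem c s)"
proof (induction c arbitrary: s)
  case (Seq c d)
  obtain t u where "t \<le> cost c" "exec c s t (sem c s)"
      "u \<le> cost d" "exec d (sem c s) u (sem d (sem c s))"
    using Seq.IH(1)[of s] Seq.IH(2)[of "sem c s"] Seq.prems by auto
  then show ?case
    by (auto intro!: exI[of _ "t + u"] exec.Seq)
next
  case (Cond b c d)
  show ?case
  proof (cases "bval s b")
    case True
    obtain t where "t \<le> cost c" "exec c s t (sem c s)"
      using Cond.IH(1)[of s] Cond.prems by auto
    then show ?thesis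
      using True by (auto intro!: exI[of _ "t + 1"] exec.CondTrue[of s b, simplified])
  next
    case False
    obtain t where "t \<le> cost d" "exec d s t (sem d s)"
      using Cond.IH(2)[of s] Cond.prems by auto
    then show ?thesis
      using False by (auto intro!: exI[of _ "t + 1"] exec.CondFalse[of s b, simplified])
  qed
qed (auto intro: exec.intros[simplified])

lemma ends_loop_free: "loop_free c \<Longrightarrow> cost c \<le> T \<Longrightarrow> Q (sem c s) \<Longrightarrow> ends c s T Q"
  unfolding ends_def using exec_sem[of c s] order_trans by fast

lemma ends_weaken: "ends c s T Q \<Longrightarrow> T \<le> U \<Longrightarrow> (\<And>s. Q s \<Longrightarrow> P s) \<Longrightarrow> ends c s U P"
  unfolding ends_def using order_trans by fast

lemma ends_Seq:
  assumes "ends c s T P" "\<And>s'. P s' \<Longrightarrow> ends d s' U Q" "T + U \<le> V"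
  shows "ends (Seq c d) s V Q"
proof -
  obtain t s' where t: "exec c s t s'" "t \<le> T" "P s'"
    using assms(1) by (auto simp: ends_def)
  obtain u s'' where u: "exec d s' u s''" "u \<le> U" "Q s''"
    using assms(2)[OF t(3)] by (auto simp: ends_def)
  have "exec (Seq c d) s (t + u) s''" "t + u \<le> V"
    using t u assms(3) by (auto intro: exec.Seq)
  then show ?thesis
    using u(3) by (auto simp: ends_def)
qed

lemma ends_Seq_loop_free:
  assumes "loop_free c" "ends d (sem c s) U Q" "cost c + U \<le> V"
  shows "ends (Seq c d) s V Q"
  using assms by (intro ends_Seq[OF ends_loop_free[where Q = "\<lambda>s'. s' = sem c s"]]) auto

text \<open>The number \<open>n\<close> of iterations is known beforehand, while \<open>t k\<close>
  may vary, as it does for types with lists of different lengths. Each iteration pays 1 for its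
  test, the failing test pays the last 1.\<close>

lemma ends_While:
  assumes "Inv 0 s"
    and step: "\<And>k s. k < n \<Longrightarrow> Inv k s \<Longrightarrow> bval s b \<and> ends c s (t k) (Inv (Suc k))"
    and stop: "\<And>s. Inv n s \<Longrightarrow> \<not> bval s b"
    and T: "(\<Sum>k<n. t k + 1) + 1 \<le> T"
  shows "ends (While b c) s T (Inv n)"
proof -
  have "Inv k s \<longrightarrow> ends (While b c) s ((\<Sum>i=k..<n. t i + 1) + 1) (Inv n)" if "k \<le> n" for k s
    using that
  proof (induction k arbitrary: s rule: inc_induct)
    case base
    show ?case
      using stop exec.WhileFalse[simplified] by (fastforce simp: ends_def)
  next
    case (step k)
    show ?case
    proof
      assume "Inv k s"
      then obtain u s' where u: "bval s b" "exec c s u s'" "u \<le> t k" "Inv (Suc k) s'"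
        using assms(2)[OF step.hyps(2), of s] by (auto simp: ends_def)
      obtain w s'' where w: "exec (While b c) s' w s''" "w \<le> (\<Sum>i=Suc k..<n. t i + 1) + 1" "Inv n s''"
        using step.IH[of s'] u(4) by (auto simp: ends_def)
      have "exec (While b c) s (u + w + 1) s''"
        using u w by (intro exec.WhileTrue)
      moreover have "u + w + 1 \<le> (\<Sum>i=k..<n. t i + 1) + 1"
        using u w step.hyps by (simp add: sum.atLeast_Suc_lessThan)
      ultimately show "ends (While b c) s ((\<Sum>i=k..<n. t i + 1) + 1) (Inv n)"
        using w by (auto simp: ends_def)
    qed
  qed
  from this[of 0 s] show ?thesis
    using assms(1) T by (auto simp: atLeast0LessThan intro: ends_weaken)
qed

section \<open>Memory updates and frame conditions\<close>

lemma nats_nat_update [simp]: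
  "nats (nat_update a i x s) a' = (if a' = a then (nats s a)(i := x) else nats s a')"
  by (simp add: nat_update_def)

lemma reals_nat_update [simp]: "reals (nat_update a i x s) = reals s"
  by (simp add: nat_update_def)

lemma reals_real_update [simp]:
  "reals (real_update a i x s) a' = (if a' = a then (reals s a)(i := x) else reals s a')"
  by (simp add: real_update_def)

lemma nats_real_update [simp]: "nats (real_update a i x s) = nats s"
  by (simp add: real_update_def)

lemma nat_update_cong: "nat_update a i x (nat_update a i y s) = nat_update a i x s"
  by (simp add: nat_update_def)

definition same_except :: "nat set \<Rightarrow> nat set \<Rightarrow> memory \<Rightarrow> memory \<Rightarrow> bool" where
  "same_except A B s s' \<longleftrightarrow>
     (\<forall>a. a \<notin> A \<longrightarrow> nats s' a = nats s a) \<and> (\<forall>a. a \<notin> B \<longrightarrow> reals s' a = reals s a)"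

lemma same_exceptD:
  assumes "same_except A B s s'"
  shows "a \<notin> A \<Longrightarrow> nats s' a = nats s a" "a \<notin> B \<Longrightarrow> reals s' a = reals s a"
  using assms by (auto simp: same_except_def)

lemma same_except_trans:
  "same_except A B s s' \<Longrightarrow> same_except A' B' s' s'' \<Longrightarrow> A \<union> A' \<subseteq> A'' \<Longrightarrow> B \<union> B' \<subseteq> B'' \<Longrightarrow>
    same_except A'' B'' s s''"
  unfolding same_except_def by (metis Un_iff subset_iff)

fun seq :: "com list \<Rightarrow> com" where
  "seq [] = Skip"
| "seq [c] = c"
| "seq (c # d # cs) = Seq c (seq (d # cs))"

abbreviation nvar :: "nat \<Rightarrow> nexp" where "nvar a \<equiv> NCell a (NConst 0)"
abbreviation rvar :: "nat \<Rightarrow> rexp" where "rvar a \<equiv> RCell a (NConst 0)"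
abbreviation nset :: "nat \<Rightarrow> nexp \<Rightarrow> com" where "nset a e \<equiv> NAssign a (NConst 0) e"
abbreviation rset :: "nat \<Rightarrow> rexp \<Rightarrow> com" where "rset a e \<equiv> RAssign a (NConst 0) e"
abbreviation incr :: "nat \<Rightarrow> com" where "incr a \<equiv> nset a (NPlus (nvar a) (NConst 1))"


subsection \<open>The programs\<close>

text \<open>Natural arrays: \<open>3\<close> number \<open>J\<close> of grid cells, \<open>4\<close> rounded capacity of the policy, \<open>5\<close> best types,
  \<open>6\<close> level of a size, \<open>7\<close> current grid point, \<open>8\<close> current type, \<open>9\<close> current outcome of it, \<open>10\<close> position
  of this outcome in the input, \<open>11\<close> best type so far.
  Real arrays: \<open>7\<close> values at the grid points, \<open>8\<close> mesh, \<open>9\<close> half of the extra capacity, \<open>10\<close> weight of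
  the penalty, \<open>11\<close> remaining capacity, \<open>12\<close> and \<open>13\<close> numerator and denominator of the Bellman
  equation, \<open>14\<close> fractional part of a size, \<open>15\<close> best value so far.\<close>

definition level_prog :: com where
  "level_prog = seq [
     nset 6 (NConst 0),
     While (BAnd (NLess (nvar 6) (nvar 3))
         (BNot (RLess (rvar 5) (RTimes (RPlus (ROfNat (nvar 6)) (RConst 1)) (rvar 8)))))
       (incr 6)]"

definition accumulate_prog :: com where
  "accumulate_prog = seq [
     rset 14 (RMinus (RDivide (rvar 5) (rvar 8)) (ROfNat (nvar 6))),
     Cond (NLess (nvar 6) (nvar 7))
       (rset 12 (RPlus (rvar 12) (RTimes (RCell 4 (nvar 10)) (RPlus (RCell 3 (nvar 10)) (RPlus
         (RTimes (RMinus (RConst 1) (rvar 14)) (RCell 7 (NMinus (nvar 7) (nvar 6))))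
         (RTimes (rvar 14) (RCell 7 (NMinus (NMinus (nvar 7) (nvar 6)) (NConst 1)))))))))
       Skip,
     Cond (NLess (nvar 6) (NConst 1))
       (rset 13 (RPlus (rvar 13) (RTimes (RCell 4 (nvar 10)) (rvar 14))))
       (rset 13 (RPlus (rvar 13) (RCell 4 (nvar 10)))),
     incr 9,
     incr 10]"

definition outcome_prog :: com where
  "outcome_prog = seq [rset 5 (RCell 2 (nvar 10)), level_prog, accumulate_prog]"

text \<open>A vanishing denominator with positive numerator reveals a profitable type of size 0. It
  becomes the decision at grid point 0, and the policy is made to start there.\<close>

definition choice_prog :: com where
  "choice_prog = seq [
     Cond (RLess (RConst 0) (rvar 13))
       (Cond (RLess (rvar 15) (RDivide (rvar 12) (rvar 13)))
         (seq [rset 15 (RDivide (rvar 12) (rvar 13)), nset 11 (nvar 8)])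
         Skip)
       (Cond (RLess (RConst 0) (rvar 12))
         (seq [nset 4 (NConst 0), nset 5 (nvar 8)])
         Skip),
     incr 8]"

definition type_init :: com where
  "type_init = seq [rset 12 (RConst 0), rset 13 (RConst 0), nset 9 (NConst 0)]"

definition type_prog :: com where
  "type_prog = seq [
     type_init,
     While (NLess (nvar 9) (NCell 1 (nvar 8))) outcome_prog,
     choice_prog]"

definition grid_point_init :: com where
  "grid_point_init = seq [
     incr 7, rset 15 (RConst 0), nset 11 (NConst 0), nset 8 (NConst 0), nset 10 (NConst 0)]"

definition grid_point_store :: com where
  "grid_point_store = seq [RAssign 7 (nvar 7) (rvar 15), NAssign 5 (nvar 7) (nvar 11)]"

definition grid_point_prog :: com where
  "grid_point_prog = seq [
     grid_point_init,
     While (NLess (nvar 8) (nvar 0)) type_prog,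
     grid_point_store]"

definition mesh_prog :: com where
  "mesh_prog = While
     (RLess (RTimes (ROfNat (nvar 3)) (RTimes (rvar 1) (RTimes (rvar 1) (rvar 1))))
       (RTimes (RConst 8) (RTimes (RPlus (rvar 0) (rvar 1)) (RPlus (rvar 0) (RDivide (rvar 1) (RConst 2))))))
     (incr 3)"

definition plan_init :: com where
  "plan_init = seq [
     rset 9 (RDivide (rvar 1) (RConst 2)),
     rset 8 (RDivide (RPlus (rvar 0) (rvar 9)) (ROfNat (nvar 3))),
     rset 11 (RPlus (rvar 0) (rvar 1)),
     nset 4 (nvar 3)]"

definition plan_finish :: com where
  "plan_finish = seq [
     rset 10 (RDivide (RCell 7 (nvar 3)) (RTimes (rvar 9) (rvar 9))),
     nset 2 (NCell 5 (nvar 4))]"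

definition plan_prog :: com where
  "plan_prog = seq [
     mesh_prog,
     plan_init,
     While (NLess (nvar 7) (nvar 3)) grid_point_prog,
     plan_finish]"

definition potential_exp :: "nexp \<Rightarrow> rexp" where
  "potential_exp m = (let e = RMinus (RMinus (rvar 11) (RTimes (ROfNat m) (rvar 8))) (rvar 9) in
     RMinus (RCell 7 m) (RTimes (rvar 10) (RTimes e e)))"

definition move_prog :: com where
  "move_prog = (let m = NMinus (nvar 4) (nvar 6); m' = NMinus m (NConst 1) in seq [
     Cond (NLess (nvar 6) (nvar 4))
       (Cond (RLess (potential_exp m') (potential_exp m)) (nset 4 m) (nset 4 m'))
       (nset 4 (NConst 0)),
     nset 2 (NCell 5 (nvar 4))])"

definition step_prog :: com where
  "step_prog = seq [rset 11 (RMinus (rvar 11) (rvar 5)), level_prog, move_prog]"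


subsection \<open>Correctness of the programs\<close>

lemma ends_level_prog:
  assumes "nats s 3 0 = J" "reals s 8 0 = \<delta>" "reals s 5 0 = x" "0 < \<delta>"
  shows "ends level_prog s (2 * J + 2) (\<lambda>s'. s' = nat_update 6 0 (level J \<delta> x) s)"
proof -
  \<comment> \<open>The loop test compares \<open>x\<close> with \<open>(k + 1) \<delta>\<close> in
    place of a floor.\<close>
  have *: "k < level J \<delta> x \<longleftrightarrow> k < J \<and> \<not> x < (real k + 1) * \<delta>" for k
  proof -
    have "k < nat \<lfloor>x / \<delta>\<rfloor> \<longleftrightarrow> int k + 1 \<le> \<lfloor>x / \<delta>\<rfloor>"
      by linarith
    also have "\<dots> \<longleftrightarrow> real k + 1 \<le> x / \<delta>"
      by (simp add: le_floor_iff)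
    also have "\<dots> \<longleftrightarrow> \<not> x < (real k + 1) * \<delta>"
      using assms(4) by (simp add: pos_le_divide_eq not_less)
    finally show ?thesis
      by (simp add: level_def)
  qed
  let ?Inv = "\<lambda>k s'. s' = nat_update 6 0 k s"
  have "ends (While (BAnd (NLess (nvar 6) (nvar 3))
         (BNot (RLess (rvar 5) (RTimes (RPlus (ROfNat (nvar 6)) (RConst 1)) (rvar 8)))))
       (incr 6)) (nat_update 6 0 0 s) (2 * J + 1) (?Inv (level J \<delta> x))"
  proof (rule ends_While[where Inv = ?Inv and n = "level J \<delta> x" and t = "\<lambda>_. 1"])
    fix k s' assume "k < level J \<delta> x" "?Inv k s'"
    then show "bval s' (BAnd (NLess (nvar 6) (nvar 3))
         (BNot (RLess (rvar 5) (RTimes (RPlus (ROfNat (nvar 6)) (RConst 1)) (rvar 8))))) \<and>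
        ends (incr 6) s' 1 (?Inv (Suc k))"
      using *[of k] assms by (auto simp: nat_update_cong intro!: ends_loop_free)
  next
    fix s' assume "?Inv (level J \<delta> x) s'"
    then show "\<not> bval s' (BAnd (NLess (nvar 6) (nvar 3))
         (BNot (RLess (rvar 5) (RTimes (RPlus (ROfNat (nvar 6)) (RConst 1)) (rvar 8)))))"
      using *[of "level J \<delta> x"] assms by auto
  qed (auto simp: level_def)
  then show ?thesis
    unfolding level_prog_def seq.simps by (intro ends_Seq_loop_free) auto
qed

definition offset :: "item_type list \<Rightarrow> nat \<Rightarrow> nat" where
  "offset I b = length (concat (take b I))"

lemma offset_Suc: "b < length I \<Longrightarrow> offset I (Suc b) = offset I b + length (I ! b)"
  by (simp add: offset_def take_Suc_conv_app_nth)

lemma nth_concat_offset: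
  assumes "b < length I" "r < length (I ! b)"
  shows "offset I b + r < length (concat I)" "concat I ! (offset I b + r) = I ! b ! r"
proof -
  have "concat I = concat (take b I) @ (I ! b @ concat (drop (Suc b) I))"
    using assms(1) by (metis append_take_drop_id concat.simps(2) concat_append id_take_nth_drop append.assoc)
  then show "offset I b + r < length (concat I)" "concat I ! (offset I b + r) = I ! b ! r"
    using assms(2) by (auto simp: offset_def nth_append)
qed

definition holds_input :: "item_type list \<Rightarrow> memory \<Rightarrow> bool" where
  "holds_input I s \<longleftrightarrow> nats s 0 0 = length I \<and> (\<forall>b<length I. nats s 1 b = length (I ! b) \<and>
     (\<forall>r<length (I ! b). reals s 2 (offset I b + r) = fst (fst (I ! b ! r)) \<and>
        reals s 3 (offset I b + r) = snd (fst (I ! b ! r)) \<and>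
        reals s 4 (offset I b + r) = snd (I ! b ! r)))"

lemma holds_input_initial: "holds_input I (initial_memory C \<epsilon> I)"
  using nth_concat_offset by (simp add: holds_input_def initial_memory_def Let_def del: length_concat)

lemma holds_input_same_except:
  assumes "same_except A B s s'" "holds_input I s" "A \<inter> {0, 1} = {}" "B \<inter> {2, 3, 4} = {}"
  shows "holds_input I s'"
proof -
  have "nats s' 0 = nats s 0" "nats s' 1 = nats s 1"
      "reals s' 2 = reals s 2" "reals s' 3 = reals s 3" "reals s' 4 = reals s 4"
    using assms(3,4) by (auto intro!: same_exceptD[OF assms(1)])
  then show ?thesis
    using assms(2) by (simp add: holds_input_def)
qed

text \<open>The value at the grid point \<open>j\<close> under consideration is still \<open>0\<close>, which makes up for the
  distinction of cases in \<open>gain\<close>.\<close>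

lemma ends_outcomes:
  assumes "nats s 3 0 = J" "reals s 8 0 = \<delta>" "0 < \<delta>" "nats s 7 0 = j" "nats s 8 0 = b" "b < length I"
    and input: "holds_input I s" and "nats s 9 0 = 0" "nats s 10 0 = offset I b"
    and "reals s 12 0 = 0" "reals s 13 0 = 0" "reals s 7 j = 0"
  shows "ends (While (NLess (nvar 9) (NCell 1 (nvar 8))) outcome_prog) s
    (length (I ! b) * (2 * J + 20) + 1) (\<lambda>s'. same_except {6, 9, 10} {5, 12, 13, 14} s s' \<and>
      nats s' 10 0 = offset I (Suc b) \<and> reals s' 12 0 = expect (I ! b) (gain J \<delta> (reals s 7) j) \<and>
      reals s' 13 0 = turn J \<delta> (I ! b))"
proof -
  let ?w = "\<lambda>q. snd (I ! b ! q)" and ?x = "\<lambda>q. fst (fst (I ! b ! q))" and ?p = "\<lambda>q. snd (fst (I ! b ! q))"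
  let ?l = "level J \<delta>"
  let ?Inv = "\<lambda>r s'. same_except {6, 9, 10} {5, 12, 13, 14} s s' \<and>
      nats s' 9 0 = r \<and> nats s' 10 0 = offset I b + r \<and>
      reals s' 12 0 = (\<Sum>q<r. ?w q * gain J \<delta> (reals s 7) j (?x q) (?p q)) \<and>
      reals s' 13 0 = (\<Sum>q<r. ?w q * (if ?l (?x q) = 0 then rest J \<delta> (?x q) else 1))"
  have "ends (While (NLess (nvar 9) (NCell 1 (nvar 8))) outcome_prog) s
    (length (I ! b) * (2 * J + 20) + 1) (?Inv (length (I ! b)))"
  proof (rule ends_While[where Inv = ?Inv and n = "length (I ! b)" and t = "\<lambda>_. 2 * J + 19"])
    fix r s' assume r: "r < length (I ! b)" and inv: "?Inv r s'"
    note same = same_exceptD[OF inv[THEN conjunct1]]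
    have eq: "nats s' 3 = nats s 3" "nats s' 7 = nats s 7" "nats s' 8 = nats s 8" "nats s' 1 = nats s 1"
      "reals s' 8 = reals s 8" "reals s' 7 = reals s 7"
      "reals s' 2 = reals s 2" "reals s' 3 = reals s 3" "reals s' 4 = reals s 4"
      by (simp_all add: same)
    have inp: "nats s 1 b = length (I ! b)" "reals s 2 (offset I b + r) = ?x r"
      "reals s 3 (offset I b + r) = ?p r" "reals s 4 (offset I b + r) = ?w r"
      using input r assms(6) by (auto simp: holds_input_def)
    define s1 where "s1 = real_update 5 0 (?x r) s'"
    have 1: "ends level_prog s1 (2 * J + 2) (\<lambda>t. t = nat_update 6 0 (?l (?x r)) s1)"
      using assms eq by (intro ends_level_prog) (auto simp: s1_def)
    define s2 where "s2 = sem accumulate_prog (nat_update 6 0 (?l (?x r)) s1)"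
    have f: "?x r / \<delta> - real (?l (?x r)) = rest J \<delta> (?x r)"
      by (simp add: rest_def)
    have "same_except {6, 9, 10} {5, 12, 13, 14} s' s2" "nats s2 9 0 = Suc r"
      "nats s2 10 0 = offset I b + Suc r"
      using inv by (simp_all add: s2_def s1_def accumulate_prog_def same_except_def)
    moreover have "reals s2 12 0 = reals s' 12 0 + ?w r * gain J \<delta> (reals s 7) j (?x r) (?p r)"
      using inv eq inp assms f
      by (simp add: s2_def s1_def accumulate_prog_def gain_def Let_def)
    moreover have "reals s2 13 0 =
        reals s' 13 0 + ?w r * (if ?l (?x r) = 0 then rest J \<delta> (?x r) else 1)"
      using inv eq inp assms f by (simp add: s2_def s1_def accumulate_prog_def)
    ultimately have Inv: "?Inv (Suc r) s2"
      using inv by (auto intro: same_except_trans)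
    have "ends outcome_prog s' (2 * J + 19) (?Inv (Suc r))"
      unfolding outcome_prog_def seq.simps
    proof (rule ends_Seq_loop_free)
      show "ends (Seq level_prog accumulate_prog) (sem (rset 5 (RCell 2 (nvar 10))) s')
        (2 * J + 18) (?Inv (Suc r))"
      proof (rule ends_Seq)
        show "ends level_prog (sem (rset 5 (RCell 2 (nvar 10))) s') (2 * J + 2)
            (\<lambda>t. t = nat_update 6 0 (?l (?x r)) s1)"
          using 1 inv eq inp by (simp add: s1_def)
        show "ends accumulate_prog t 16 (?Inv (Suc r))" if "t = nat_update 6 0 (?l (?x r)) s1" for t
          unfolding that using Inv unfolding s2_def
          by (rule ends_loop_free[rotated 2]) (simp_all add: accumulate_prog_def)
      qed simp
    qed simp_all
    then show "bval s' (NLess (nvar 9) (NCell 1 (nvar 8))) \<and> ends outcome_prog s' (2 * J + 19) (?Inv (Suc r))"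
      using inv eq inp r assms by simp
  next
    fix s' assume inv: "?Inv (length (I ! b)) s'"
    then have "nats s' 8 = nats s 8" "nats s' 1 = nats s 1"
      using same_exceptD by auto
    then show "\<not> bval s' (NLess (nvar 9) (NCell 1 (nvar 8)))"
      using inv input assms by (simp add: holds_input_def)
  qed (use assms in \<open>simp_all add: same_except_def\<close>)
  then show ?thesis
    by (rule ends_weaken) (use assms in \<open>auto simp: offset_Suc expect_def turn_def\<close>)
qed


text \<open>Cell 0 of array 5 is available for a type of size 0, since grid point 0 has value 0 and
  no Bellman choice; otherwise any valid index may stand there.\<close>

definition start_ok :: "nat \<Rightarrow> real \<Rightarrow> item_type list \<Rightarrow> item_type set \<Rightarrow> memory \<Rightarrow> bool" where
  "start_ok J \<delta> I B s \<longleftrightarrow> nats s 5 0 < length I \<and>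
     (nats s 4 0 = J \<and> (\<forall>b\<in>B. turn J \<delta> b = 0 \<longrightarrow> expect b (\<lambda>x p. p) \<le> 0) \<or>
      nats s 4 0 = 0 \<and> turn J \<delta> (I ! nats s 5 0) = 0 \<and> 0 < expect (I ! nats s 5 0) (\<lambda>x p. p))"

text \<open>\<open>gain\<close> at \<open>j\<close> reads \<open>v\<close> strictly below
  \<open>j\<close>. Hence storing the value at \<open>j\<close> disturbs neither its own equation
  nor those solved before.\<close>

lemma optimal_choice_cong:
  assumes "\<And>m. m < j \<Longrightarrow> v m = v' m"
  shows "optimal_choice J \<delta> I v j B u i = optimal_choice J \<delta> I v' j B u i"
proof -
  have "gain J \<delta> v j = gain J \<delta> v' j"
    using assms by (auto simp: gain_def Let_def fun_eq_iff)
  then show ?thesis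
    by (simp add: optimal_choice_def)
qed

lemma input_size_eq: "input_size I = (\<Sum>b<length I. length (I ! b))"
  by (simp add: input_size_def sum_list_sum_nth atLeast0LessThan)

context grid
begin

lemma choice_prog_correct:
  assumes q: "q < length I" and j: "0 < j" "j = nats s 7 0" and v: "v = reals s 7"
    and "nats s 8 0 = q"
    and 12: "reals s 12 0 = expect (I ! q) (gain J \<delta> v j)" and 13: "reals s 13 0 = turn J \<delta> (I ! q)"
    and opt: "optimal_choice J \<delta> I v j (set (take q I)) (reals s 15 0) (nats s 11 0)"
    and start: "start_ok J \<delta> I B s"
    and s': "s' = sem choice_prog s"
  shows "optimal_choice J \<delta> I v j (set (take (Suc q) I)) (reals s' 15 0) (nats s' 11 0)"
    "start_ok J \<delta> I (insert (I ! q) B) s'" "nats s' 8 0 = Suc q" "0 < m \<Longrightarrow> nats s' 5 m = nats s 5 m"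
    "same_except {4, 5, 8, 11} {15} s s'"
proof -
  let ?N = "expect (I ! q) (gain J \<delta> v j)" and ?D = "turn J \<delta> (I ! q)"
  have take: "set (take (Suc q) I) = insert (I ! q) (set (take q I))"
    using q by (simp add: take_Suc_conv_app_nth)
  have b: "I ! q \<in> set I"
    using q by simp
  have D: "0 \<le> ?D"
    using b by (rule turn_nonneg)
  show "same_except {4, 5, 8, 11} {15} s s'" "nats s' 8 0 = Suc q"
      "0 < m \<Longrightarrow> nats s' 5 m = nats s 5 m"
    using assms by (simp_all add: choice_prog_def same_except_def)
  show "optimal_choice J \<delta> I v j (set (take (Suc q) I)) (reals s' 15 0) (nats s' 11 0)"
  proof (cases "0 < ?D \<and> reals s 15 0 < ?N / ?D")
    case True
    have "reals s' 15 0 = ?N / ?D" "nats s' 11 0 = q"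
      using True assms by (simp_all add: choice_prog_def)
    \<comment> \<open>Raising the best quotient preserves the inequalities of earlier types, as
      \<open>turn\<close> is nonnegative.\<close>
    moreover have "reals s 15 0 * turn J \<delta> b \<le> ?N / ?D * turn J \<delta> b" if "b \<in> set (take q I)" for b
      using True that by (intro mult_right_mono turn_nonneg) (auto dest: in_set_takeD)
    ultimately show ?thesis
      using opt True q unfolding optimal_choice_def take by fastforce
  next
    case False
    have "reals s' 15 0 = reals s 15 0" "nats s' 11 0 = nats s 11 0"
      using False assms by (auto simp: choice_prog_def)
    moreover have "?N \<le> reals s 15 0 * ?D" if "0 < ?D"
      using False that by (simp add: pos_less_divide_eq)
    ultimately show ?thesis
      using opt unfolding optimal_choice_def take by simp
  qed
  show "start_ok J \<delta> I (insert (I ! q) B) s'"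
  proof (cases "?D = 0")
    case True
    have N: "?N = expect (I ! q) (\<lambda>x p. p)"
      using b True j(1) by (rule expect_gain_free)
    show ?thesis
    proof (cases "0 < ?N")
      case True
      have "nats s' 4 0 = 0" "nats s' 5 0 = q"
        using True \<open>?D = 0\<close> assms by (simp_all add: choice_prog_def)
      then show ?thesis
        using True \<open>?D = 0\<close> N q by (simp add: start_ok_def)
    next
      case False
      have "nats s' 4 = nats s 4" "nats s' 5 = nats s 5"
        using False \<open>?D = 0\<close> assms by (simp_all add: choice_prog_def)
      then show ?thesis
        using False start N by (auto simp: start_ok_def)
    qed
  next
    case False
    have "nats s' 4 = nats s 4" "nats s' 5 = nats s 5"
      using False D assms by (simp_all add: choice_prog_def)
    then show ?thesis
      using False start by (auto simp: start_ok_def)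
  qed
qed

lemma ends_types:
  assumes "nats s 3 0 = J" "reals s 8 0 = \<delta>" "nats s 7 0 = j" "0 < j"
    and input: "holds_input I s" and "nats s 8 0 = 0" "nats s 10 0 = 0"
    and "reals s 15 0 = 0" "nats s 11 0 = 0" "reals s 7 j = 0" and start: "start_ok J \<delta> I B s"
  shows "ends (While (NLess (nvar 8) (nvar 0)) type_prog) s
    (input_size I * (2 * J + 20) + 20 * length I + 1) (\<lambda>s'.
      same_except {4, 5, 6, 8, 9, 10, 11} {5, 12, 13, 14, 15} s s' \<and>
      (\<forall>m>0. nats s' 5 m = nats s 5 m) \<and>
      optimal_choice J \<delta> I (reals s 7) j (set I) (reals s' 15 0) (nats s' 11 0) \<and>
      start_ok J \<delta> I (B \<union> set I) s')"
proof -
  let ?Inv = "\<lambda>q s'. same_except {4, 5, 6, 8, 9, 10, 11} {5, 12, 13, 14, 15} s s' \<and>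
      (\<forall>m>0. nats s' 5 m = nats s 5 m) \<and>
      optimal_choice J \<delta> I (reals s 7) j (set (take q I)) (reals s' 15 0) (nats s' 11 0) \<and>
      start_ok J \<delta> I (B \<union> set (take q I)) s' \<and> nats s' 8 0 = q \<and> nats s' 10 0 = offset I q"
  let ?t = "\<lambda>q. length (I ! q) * (2 * J + 20) + 10"
  have n: "nats s 0 0 = length I"
    using input by (simp add: holds_input_def)
  have "ends (While (NLess (nvar 8) (nvar 0)) type_prog) s
    (input_size I * (2 * J + 20) + 20 * length I + 1) (?Inv (length I))"
  proof (rule ends_While[where Inv = ?Inv and n = "length I" and t = ?t])
    fix q s' assume q: "q < length I" and inv: "?Inv q s'"
    note same = same_exceptD[OF inv[THEN conjunct1]]
    define s1 where "s1 = sem type_init s'"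
    have s1: "same_except {9} {12, 13} s' s1" "reals s1 12 0 = 0" "reals s1 13 0 = 0" "nats s1 9 0 = 0"
      by (simp_all add: s1_def type_init_def same_except_def)
    note same1 = same_exceptD[OF s1(1)]
    have eqs: "nats s1 3 = nats s 3" "reals s1 8 = reals s 8" "nats s1 7 = nats s 7"
      "nats s1 8 = nats s' 8" "nats s1 10 = nats s' 10" "reals s1 7 = reals s 7"
      "nats s1 4 = nats s' 4" "nats s1 5 = nats s' 5" "nats s1 11 = nats s' 11" "reals s1 15 = reals s' 15"
      by (simp_all add: same same1)
    have input1: "holds_input I s1"
      using holds_input_same_except[OF s1(1) holds_input_same_except[OF inv[THEN conjunct1] input]] by simp
    have outcomes: "ends (While (NLess (nvar 9) (NCell 1 (nvar 8))) outcome_prog) s1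
      (length (I ! q) * (2 * J + 20) + 1) (\<lambda>s'. same_except {6, 9, 10} {5, 12, 13, 14} s1 s' \<and>
      nats s' 10 0 = offset I (Suc q) \<and> reals s' 12 0 = expect (I ! q) (gain J \<delta> (reals s1 7) j) \<and>
      reals s' 13 0 = turn J \<delta> (I ! q))"
      using assms inv q by (intro ends_outcomes \<delta> input1) (simp_all add: eqs s1)
    have "ends type_prog s' (?t q) (?Inv (Suc q))"
      unfolding type_prog_def seq.simps
    proof (rule ends_Seq_loop_free)
      show "ends (Seq (While (NLess (nvar 9) (NCell 1 (nvar 8))) outcome_prog) choice_prog)
        (sem type_init s') (length (I ! q) * (2 * J + 20) + 7) (?Inv (Suc q))"
        unfolding s1_def[symmetric]
      proof (rule ends_Seq[OF outcomes])
        fix s2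
        assume s2: "same_except {6, 9, 10} {5, 12, 13, 14} s1 s2 \<and>
          nats s2 10 0 = offset I (Suc q) \<and> reals s2 12 0 = expect (I ! q) (gain J \<delta> (reals s1 7) j) \<and>
          reals s2 13 0 = turn J \<delta> (I ! q)"
        note same2 = same_exceptD[OF s2[THEN conjunct1]]
        have eqs2: "nats s2 7 = nats s 7" "nats s2 8 = nats s' 8" "nats s2 11 = nats s' 11"
          "reals s2 15 = reals s' 15" "reals s2 7 = reals s 7" "nats s2 4 = nats s' 4" "nats s2 5 = nats s' 5"
          by (simp_all add: same2 eqs)
        define s3 where "s3 = sem choice_prog s2"
        have "start_ok J \<delta> I (B \<union> set (take q I)) s2"
          using inv by (simp add: start_ok_def eqs2)
        moreover have "optimal_choice J \<delta> I (reals s 7) j (set (take q I)) (reals s2 15 0) (nats s2 11 0)"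
          using inv by (simp add: eqs2)
        ultimately have s3:
            "optimal_choice J \<delta> I (reals s 7) j (set (take (Suc q) I)) (reals s3 15 0) (nats s3 11 0)"
            "start_ok J \<delta> I (insert (I ! q) (B \<union> set (take q I))) s3" "nats s3 8 0 = Suc q"
            "\<And>m. 0 < m \<Longrightarrow> nats s3 5 m = nats s2 5 m" "same_except {4, 5, 8, 11} {15} s2 s3"
          using choice_prog_correct[OF q assms(4), of s2 "reals s 7" "B \<union> set (take q I)" s3]
            inv s2 assms(3) by (simp_all add: eqs eqs2 s3_def)
        have "same_except {4, 5, 6, 8, 9, 10, 11} {5, 12, 13, 14, 15} s s1"
          using inv s1(1) by (auto intro: same_except_trans)
        then have "same_except {4, 5, 6, 8, 9, 10, 11} {5, 12, 13, 14, 15} s s2"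
          using s2 by (auto intro: same_except_trans)
        then have "same_except {4, 5, 6, 8, 9, 10, 11} {5, 12, 13, 14, 15} s s3"
          using s3(5) by (auto intro: same_except_trans)
        moreover have "nats s3 10 0 = offset I (Suc q)"
          using s2 same_exceptD(1)[OF s3(5), of 10] by simp
        moreover have "insert (I ! q) (B \<union> set (take q I)) = B \<union> set (take (Suc q) I)"
          using q by (auto simp: take_Suc_conv_app_nth)
        ultimately have "?Inv (Suc q) s3"
          using s3 inv by (simp add: eqs2)
        then show "ends choice_prog s2 6 (?Inv (Suc q))"
          unfolding s3_def by (rule ends_loop_free[rotated 2]) (simp_all add: choice_prog_def)
      qed simp
    qed (simp_all add: type_init_def)
    then show "bval s' (NLess (nvar 8) (nvar 0)) \<and> ends type_prog s' (?t q) (?Inv (Suc q))"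
      using inv q n by (simp add: same)
  next
    fix s' assume inv: "?Inv (length I) s'"
    show "\<not> bval s' (NLess (nvar 8) (nvar 0))"
      using inv n same_exceptD(1)[OF inv[THEN conjunct1], of 0] by simp
  next
    show "?Inv 0 s"
      using assms valid by (simp add: same_except_def optimal_choice_def offset_def valid_instance_def)
    have "(\<Sum>q<length I. ?t q + 1) = input_size I * (2 * J + 20) + 11 * length I"
      by (simp add: input_size_eq sum.distrib sum_distrib_right add_mult_distrib2)
    then show "(\<Sum>q<length I. ?t q + 1) + 1 \<le> input_size I * (2 * J + 20) + 20 * length I + 1"
      by simp
  qed
  then show ?thesis
    by (rule ends_weaken) auto
qed

lemma ends_grid_points:
  assumes "nats s 3 0 = J" "reals s 8 0 = \<delta>" "nats s 7 0 = 0" "reals s 7 = (\<lambda>_. 0)"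
    and input: "holds_input I s" and start: "start_ok J \<delta> I {} s"
  shows "ends (While (NLess (nvar 7) (nvar 3)) grid_point_prog) s
    (J * (input_size I * (2 * J + 60)) + 1) (\<lambda>s'.
      same_except {4, 5, 6, 7, 8, 9, 10, 11} {5, 7, 12, 13, 14, 15} s s' \<and> reals s' 7 0 = 0 \<and>
      (\<forall>j. 0 < j \<longrightarrow> j \<le> J \<longrightarrow> optimal_choice J \<delta> I (reals s' 7) j (set I) (reals s' 7 j) (nats s' 5 j)) \<and>
      start_ok J \<delta> I (set I) s')"
proof -
  \<comment> \<open>The first grid point already examines all types for size 0; later ones repeat
    the test consistently, as the numerator of such a type is its expected profit at every
    \<open>j > 0\<close>.\<close>
  let ?Inv = "\<lambda>l s'. same_except {4, 5, 6, 7, 8, 9, 10, 11} {5, 7, 12, 13, 14, 15} s s' \<and>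
      nats s' 7 0 = l \<and> (\<forall>j. j = 0 \<or> l < j \<longrightarrow> reals s' 7 j = 0) \<and>
      (\<forall>j. 0 < j \<longrightarrow> j \<le> l \<longrightarrow> optimal_choice J \<delta> I (reals s' 7) j (set I) (reals s' 7 j) (nats s' 5 j)) \<and>
      start_ok J \<delta> I (if l = 0 then {} else set I) s'"
  let ?t = "input_size I * (2 * J + 20) + 20 * length I + 8"
  have "ends (While (NLess (nvar 7) (nvar 3)) grid_point_prog) s
    (J * (input_size I * (2 * J + 60)) + 1) (?Inv J)"
  proof (rule ends_While[where Inv = ?Inv and n = J and t = "\<lambda>_. ?t"])
    fix l s' assume l: "l < J" and inv: "?Inv l s'"
    note same = same_exceptD[OF inv[THEN conjunct1]]
    define s1 where "s1 = sem grid_point_init s'"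
    have s1: "same_except {7, 8, 10, 11} {15} s' s1" "nats s1 7 0 = Suc l" "reals s1 15 0 = 0"
        "nats s1 11 0 = 0" "nats s1 8 0 = 0" "nats s1 10 0 = 0"
      using inv by (simp_all add: s1_def grid_point_init_def same_except_def)
    note same1 = same_exceptD[OF s1(1)]
    have eqs: "nats s1 3 = nats s 3" "reals s1 8 = reals s 8" "reals s1 7 = reals s' 7"
      "nats s1 4 = nats s' 4" "nats s1 5 = nats s' 5"
      by (simp_all add: same same1)
    have input1: "holds_input I s1"
      using holds_input_same_except[OF s1(1) holds_input_same_except[OF inv[THEN conjunct1] input]] by simp
    have start1: "start_ok J \<delta> I (if l = 0 then {} else set I) s1"
      using inv by (simp add: start_ok_def eqs)
    have types: "ends (While (NLess (nvar 8) (nvar 0)) type_prog) s1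
      (input_size I * (2 * J + 20) + 20 * length I + 1) (\<lambda>s'.
        same_except {4, 5, 6, 8, 9, 10, 11} {5, 12, 13, 14, 15} s1 s' \<and>
        (\<forall>m>0. nats s' 5 m = nats s1 5 m) \<and>
        optimal_choice J \<delta> I (reals s1 7) (Suc l) (set I) (reals s' 15 0) (nats s' 11 0) \<and>
        start_ok J \<delta> I ((if l = 0 then {} else set I) \<union> set I) s')"
      using assms inv by (intro ends_types input1 start1) (simp_all add: eqs s1)
    have "ends grid_point_prog s' ?t (?Inv (Suc l))"
      unfolding grid_point_prog_def seq.simps
    proof (rule ends_Seq_loop_free)
      show "ends (Seq (While (NLess (nvar 8) (nvar 0)) type_prog) grid_point_store) (sem grid_point_init s')
        (input_size I * (2 * J + 20) + 20 * length I + 3) (?Inv (Suc l))"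
        unfolding s1_def[symmetric]
      proof (rule ends_Seq[OF types])
        fix s2
        assume s2: "same_except {4, 5, 6, 8, 9, 10, 11} {5, 12, 13, 14, 15} s1 s2 \<and>
          (\<forall>m>0. nats s2 5 m = nats s1 5 m) \<and>
          optimal_choice J \<delta> I (reals s1 7) (Suc l) (set I) (reals s2 15 0) (nats s2 11 0) \<and>
          start_ok J \<delta> I ((if l = 0 then {} else set I) \<union> set I) s2"
        note same2 = same_exceptD[OF s2[THEN conjunct1]]
        have eqs2: "nats s2 7 = nats s1 7" "reals s2 7 = reals s' 7"
          by (simp_all add: same2 eqs)
        define s3 where "s3 = sem grid_point_store s2"
        have s3: "same_except {5} {7} s2 s3" "nats s3 7 0 = Suc l"
            "reals s3 7 = (reals s' 7)(Suc l := reals s2 15 0)"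
            "nats s3 5 = (nats s2 5)(Suc l := nats s2 11 0)" "nats s3 4 = nats s2 4"
          using s1(2) by (simp_all add: s3_def grid_point_store_def same_except_def eqs2)
        have "same_except {4, 5, 6, 7, 8, 9, 10, 11} {5, 7, 12, 13, 14, 15} s s1"
          using inv s1(1) by (auto intro: same_except_trans)
        then have "same_except {4, 5, 6, 7, 8, 9, 10, 11} {5, 7, 12, 13, 14, 15} s s2"
          using s2 by (auto intro: same_except_trans)
        then have "same_except {4, 5, 6, 7, 8, 9, 10, 11} {5, 7, 12, 13, 14, 15} s s3"
          using s3(1) by (auto intro: same_except_trans)
        moreover have "optimal_choice J \<delta> I (reals s3 7) j (set I) (reals s3 7 j) (nats s3 5 j)"
          if j: "0 < j" "j \<le> Suc l" for j
        proof (cases "j = Suc l")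
          case True
          then show ?thesis
            using s2 optimal_choice_cong[of j "reals s3 7" "reals s1 7"] by (simp add: s3 eqs)
        next
          case False
          then show ?thesis
            using j inv s2 optimal_choice_cong[of j "reals s3 7" "reals s' 7"] by (simp add: s3 eqs)
        qed
        moreover have "start_ok J \<delta> I (set I) s3"
          using s2 by (cases "l = 0") (simp_all add: start_ok_def s3)
        ultimately have "?Inv (Suc l) s3"
          using s3 inv by simp
        then show "ends grid_point_store s2 2 (?Inv (Suc l))"
          unfolding s3_def by (rule ends_loop_free[rotated 2]) (simp_all add: grid_point_store_def)
      qed simp
    qed (simp_all add: grid_point_init_def)
    then show "bval s' (NLess (nvar 7) (nvar 3)) \<and> ends grid_point_prog s' ?t (?Inv (Suc l))"
      using inv l assms(1) by (simp add: same)
  next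
    fix s' assume inv: "?Inv J s'"
    show "\<not> bval s' (NLess (nvar 7) (nvar 3))"
      using inv assms(1) same_exceptD(1)[OF inv[THEN conjunct1], of 3] by simp
  next
    show "?Inv 0 s"
      using assms by (simp add: same_except_def)
    \<comment> \<open>The overheads per type and per grid point are charged to the input
      size.\<close>
    have "1 \<le> length I" "length I \<le> input_size I"
      using valid length_le_input_size[OF valid] by (auto simp: valid_instance_def Suc_le_eq)
    then have "?t + 1 \<le> input_size I * (2 * J + 60)"
      by (simp add: algebra_simps)
    then have "J * (?t + 1) \<le> J * (input_size I * (2 * J + 60))"
      by (rule mult_le_mono2)
    then show "(\<Sum>l<J. ?t + 1) + 1 \<le> J * (input_size I * (2 * J + 60)) + 1"
      by simp
  qed
  \<comment> \<open>\<open>0 \<le> C < J \<delta>\<close> forces \<open>0 < J\<close>, so the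
    invariant ends with all of \<open>set I\<close> examined.\<close>
  then show ?thesis
    by (rule ends_weaken) (use C C_less in \<open>auto split: if_splits\<close>)
qed

end

subsection \<open>The choice of the grid\<close>

definition mesh_count :: "real \<Rightarrow> real \<Rightarrow> nat" where
  "mesh_count C \<epsilon> = (LEAST J. \<not> real J * (\<epsilon> * (\<epsilon> * \<epsilon>)) < 8 * ((C + \<epsilon>) * (C + \<epsilon> / 2)))"

lemma mesh_count_less:
  "k < mesh_count C \<epsilon> \<Longrightarrow> real k * (\<epsilon> * (\<epsilon> * \<epsilon>)) < 8 * ((C + \<epsilon>) * (C + \<epsilon> / 2))"
  unfolding mesh_count_def using not_less_Least by blast

lemma mesh_count_ge:
  assumes "0 < \<epsilon>"
  shows "8 * ((C + \<epsilon>) * (C + \<epsilon> / 2)) \<le> real (mesh_count C \<epsilon>) * (\<epsilon> * (\<epsilon> * \<epsilon>))"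
proof -
  obtain k :: nat where "8 * ((C + \<epsilon>) * (C + \<epsilon> / 2)) / (\<epsilon> * (\<epsilon> * \<epsilon>)) < real k"
    using reals_Archimedean2 by blast
  then have "\<not> real k * (\<epsilon> * (\<epsilon> * \<epsilon>)) < 8 * ((C + \<epsilon>) * (C + \<epsilon> / 2))"
    using assms by (simp add: pos_divide_less_eq)
  then have "\<not> real (mesh_count C \<epsilon>) * (\<epsilon> * (\<epsilon> * \<epsilon>)) < 8 * ((C + \<epsilon>) * (C + \<epsilon> / 2))"
    unfolding mesh_count_def by (rule LeastI)
  then show ?thesis
    by simp
qed

lemma mesh_count_pos:
  assumes "0 \<le> C" "0 < \<epsilon>"
  shows "0 < mesh_count C \<epsilon>"
proof (rule ccontr)
  assume "\<not> ?thesis"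
  then have "8 * ((C + \<epsilon>) * (C + \<epsilon> / 2)) \<le> 0"
    using mesh_count_ge[OF assms(2), of C] by simp
  moreover have "0 < (C + \<epsilon>) * (C + \<epsilon> / 2)"
    using assms by (intro mult_pos_pos) auto
  ultimately show False
    by linarith
qed

text \<open>Minimality bounds \<open>J - 1\<close>, not \<open>J\<close>. The summand 2 lifts this
  to \<open>J + 1\<close>, the quantity that enters the time bound.\<close>

lemma mesh_count_le:
  assumes "0 \<le> C" "0 < \<epsilon>"
  shows "real (mesh_count C \<epsilon>) + 1 \<le> (2 + 8 * (C + 1)\<^sup>2) * (1 + 1 / \<epsilon>) ^ 3"
proof -
  define u where "u = 1 / \<epsilon>"
  have u: "0 < u" "\<epsilon> * u = 1"
    using assms by (simp_all add: u_def)
  have "real (mesh_count C \<epsilon> - 1) * (\<epsilon> * (\<epsilon> * \<epsilon>)) < 8 * ((C + \<epsilon>) * (C + \<epsilon> / 2))"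
    using mesh_count_pos[OF assms] by (intro mesh_count_less) simp
  then have "(real (mesh_count C \<epsilon>) - 1) * (\<epsilon> * (\<epsilon> * \<epsilon>)) < 8 * ((C + \<epsilon>) * (C + \<epsilon> / 2))"
    using mesh_count_pos[OF assms] by (simp add: of_nat_diff)
  also have "\<dots> \<le> 8 * ((C + \<epsilon>) * (C + \<epsilon>))"
    using assms by (intro mult_left_mono) auto
  finally have "(real (mesh_count C \<epsilon>) - 1) * (\<epsilon> * (\<epsilon> * \<epsilon>)) * u ^ 3
      \<le> 8 * ((C + \<epsilon>) * (C + \<epsilon>)) * u ^ 3"
    using u by (intro mult_right_mono) auto
  also have "(real (mesh_count C \<epsilon>) - 1) * (\<epsilon> * (\<epsilon> * \<epsilon>)) * u ^ 3 =
      (real (mesh_count C \<epsilon>) - 1) * (\<epsilon> * u) ^ 3"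
    by (simp add: power_mult_distrib power3_eq_cube)
  also have "8 * ((C + \<epsilon>) * (C + \<epsilon>)) * u ^ 3 = 8 * (C * u + \<epsilon> * u)\<^sup>2 * u"
    by (simp add: power2_eq_square power3_eq_cube algebra_simps)
  finally have "real (mesh_count C \<epsilon>) - 1 \<le> 8 * (C * u + 1)\<^sup>2 * u"
    by (simp add: u)
  also have "\<dots> \<le> 8 * ((C + 1) * (1 + u))\<^sup>2 * (1 + u)"
    using assms u by (intro mult_mono power_mono) (auto simp: algebra_simps)
  also have "\<dots> = 8 * (C + 1)\<^sup>2 * (1 + u) ^ 3"
    by (simp add: power_mult_distrib power2_eq_square power3_eq_cube)
  finally have "real (mesh_count C \<epsilon>) + 1 \<le> 2 * 1 + 8 * (C + 1)\<^sup>2 * (1 + u) ^ 3"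
    by simp
  also have "\<dots> \<le> 2 * (1 + u) ^ 3 + 8 * (C + 1)\<^sup>2 * (1 + u) ^ 3"
    using u by (intro add_right_mono mult_left_mono one_le_power) auto
  finally show ?thesis
    by (simp add: u_def algebra_simps)
qed

lemma nat_update_same: "nat_update a i (nats s a i) s = s"
  by (simp add: nat_update_def)

lemma ends_mesh_prog:
  assumes "nats s 3 0 = 0" "reals s 0 0 = C" "reals s 1 0 = \<epsilon>" "0 < \<epsilon>"
  shows "ends mesh_prog s (2 * mesh_count C \<epsilon> + 1) (\<lambda>s'. s' = nat_update 3 0 (mesh_count C \<epsilon>) s)"
  unfolding mesh_prog_def
proof (rule ends_While[where Inv = "\<lambda>k s'. s' = nat_update 3 0 k s" and n = "mesh_count C \<epsilon>" and t = "\<lambda>_. 1"],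
    goal_cases)
  case 1
  show ?case
    using nat_update_same[of 3 0 s] assms(1) by simp
next
  case (2 k s')
  then show ?case
    using mesh_count_less[of k C \<epsilon>] assms
    by (auto simp: nat_update_cong of_rat_divide intro!: ends_loop_free)
next
  case (3 s')
  then show ?case
    using mesh_count_ge[OF assms(4), of C] assms by simp
qed simp

subsection \<open>Correctness of the whole programs\<close>

definition policy_memory ::
  "nat \<Rightarrow> real \<Rightarrow> real \<Rightarrow> real \<Rightarrow> (nat \<Rightarrow> real) \<Rightarrow> (nat \<Rightarrow> nat) \<Rightarrow> real \<times> nat \<Rightarrow> memory \<Rightarrow> bool" where
  "policy_memory J \<delta> a \<mu> v best st s \<longleftrightarrow>
     nats s 3 0 = J \<and> reals s 8 0 = \<delta> \<and> reals s 9 0 = a \<and> reals s 10 0 = \<mu> \<and> reals s 7 = v \<and>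
     nats s 5 = best \<and> reals s 11 0 = fst st \<and> nats s 4 0 = snd st \<and> decision s = best (snd st)"

lemma ends_step_prog:
  assumes "policy_memory J \<delta> a \<mu> v best st s" "0 < \<delta>"
  shows "ends step_prog (observe z s) (2 * J + 12) (policy_memory J \<delta> a \<mu> v best (next_state J \<delta> a \<mu> v st z))"
proof -
  let ?l = "level J \<delta> (fst z)"
  define s1 where "s1 = sem (rset 11 (RMinus (rvar 11) (rvar 5))) (observe z s)"
  have 1: "ends level_prog s1 (2 * J + 2) (\<lambda>s'. s' = nat_update 6 0 ?l s1)"
    using assms by (intro ends_level_prog) (auto simp: s1_def observe_def policy_memory_def)
  have 2: "policy_memory J \<delta> a \<mu> v best (next_state J \<delta> a \<mu> v st z)
      (sem move_prog (nat_update 6 0 ?l s1))"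
    using assms unfolding policy_memory_def
    by (simp add: s1_def observe_def move_prog_def Let_def next_state_def decision_def
        potential_exp_def potential_def power2_eq_square)
  show ?thesis
    unfolding step_prog_def seq.simps
  proof (rule ends_Seq_loop_free)
    show "ends (Seq level_prog move_prog) (sem (rset 11 (RMinus (rvar 11) (rvar 5))) (observe z s)) (2 * J + 11)
      (policy_memory J \<delta> a \<mu> v best (next_state J \<delta> a \<mu> v st z))"
      unfolding s1_def[symmetric]
      by (rule ends_Seq[OF 1, where U = 9])
        (use 2 in \<open>auto simp: move_prog_def Let_def intro!: ends_loop_free\<close>)
  qed simp_all
qed

lemma responds_step_prog:
  assumes "policy_memory J \<delta> a \<mu> v best st s" "0 < \<delta>" "real (2 * J + 12) \<le> T"
  shows "\<exists>s'. responds step_prog T s h s' \<and>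
    policy_memory J \<delta> a \<mu> v best (foldl (next_state J \<delta> a \<mu> v) st h) s'"
proof (induction h rule: rev_induct)
  case Nil
  show ?case
    using assms(1) by (auto intro: responds.Nil)
next
  case (snoc z h)
  then obtain s' where s': "responds step_prog T s h s'"
      "policy_memory J \<delta> a \<mu> v best (foldl (next_state J \<delta> a \<mu> v) st h) s'"
    by blast
  obtain t s'' where t: "exec step_prog (observe z s') t s''" "t \<le> 2 * J + 12"
      "policy_memory J \<delta> a \<mu> v best (next_state J \<delta> a \<mu> v (foldl (next_state J \<delta> a \<mu> v) st h) z) s''"
    using ends_step_prog[OF s'(2) assms(2), of z] by (auto simp: ends_def)
  have "responds step_prog T s (h @ [z]) s''"
    using s'(1) t(1) by (rule responds.snoc) (use t(2) assms(3) in linarith)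
  then show ?case
    using t(3) by auto
qed

lemma ends_plan_prog:
  fixes C \<epsilon> :: real
  defines "J \<equiv> mesh_count C \<epsilon>" and "a \<equiv> \<epsilon> / 2"
  defines "\<delta> \<equiv> (C + a) / real J"
  assumes grid: "grid C \<delta> J I" and \<epsilon>: "0 < \<epsilon>"
  shows "ends plan_prog (initial_memory C \<epsilon> I) (2 * J + J * (input_size I * (2 * J + 60)) + 10)
    (\<lambda>s. \<exists>v best j. policy_memory J \<delta> a (v J / a\<^sup>2) v best (C + \<epsilon>, j) s \<and> v 0 = 0 \<and>
      (\<forall>j. 0 < j \<longrightarrow> j \<le> J \<longrightarrow> optimal_choice J \<delta> I v j (set I) (v j) (best j)) \<and> best 0 < length I \<and>
      (j = J \<and> (\<forall>b\<in>set I. turn J \<delta> b = 0 \<longrightarrow> expect b (\<lambda>x p. p) \<le> 0) \<or>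
       j = 0 \<and> turn J \<delta> (I ! best 0) = 0 \<and> 0 < expect (I ! best 0) (\<lambda>x p. p)))"
    (is "ends _ _ _ ?Q")
proof -
  interpret grid C \<delta> J I
    by (rule grid)
  define s0 where "s0 = initial_memory C \<epsilon> I"
  have s0: "nats s0 3 0 = 0" "reals s0 0 0 = C" "reals s0 1 0 = \<epsilon>" "nats s0 7 0 = 0"
      "reals s0 7 = (\<lambda>_. 0)" "nats s0 5 0 = 0"
    by (simp_all add: s0_def initial_memory_def Let_def fun_eq_iff)
  define s1 where "s1 = nat_update 3 0 J s0"
  define s2 where "s2 = sem plan_init s1"
  have s2: "nats s2 3 0 = J" "reals s2 9 0 = a" "reals s2 8 0 = \<delta>" "reals s2 11 0 = C + \<epsilon>"
      "nats s2 4 0 = J" "nats s2 7 0 = 0" "reals s2 7 = (\<lambda>_. 0)" "nats s2 5 0 = 0"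
      "same_except {3, 4} {8, 9, 11} s0 s2"
    using s0 by (simp_all add: s2_def s1_def plan_init_def a_def \<delta>_def same_except_def)
  have "holds_input I s2"
    using holds_input_same_except[OF s2(9)] holds_input_initial[of I C \<epsilon>] by (simp add: s0_def)
  moreover have "start_ok J \<delta> I {} s2"
    using valid by (simp add: start_ok_def s2 valid_instance_def)
  ultimately have points: "ends (While (NLess (nvar 7) (nvar 3)) grid_point_prog) s2
    (J * (input_size I * (2 * J + 60)) + 1) (\<lambda>s'.
      same_except {4, 5, 6, 7, 8, 9, 10, 11} {5, 7, 12, 13, 14, 15} s2 s' \<and> reals s' 7 0 = 0 \<and>
      (\<forall>j. 0 < j \<longrightarrow> j \<le> J \<longrightarrow> optimal_choice J \<delta> I (reals s' 7) j (set I) (reals s' 7 j) (nats s' 5 j)) \<and>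
      start_ok J \<delta> I (set I) s')"
    using s2 by (intro ends_grid_points)
  have finish: "ends plan_finish s3 2 ?Q"
    if s3: "same_except {4, 5, 6, 7, 8, 9, 10, 11} {5, 7, 12, 13, 14, 15} s2 s3 \<and> reals s3 7 0 = 0 \<and>
      (\<forall>j. 0 < j \<longrightarrow> j \<le> J \<longrightarrow> optimal_choice J \<delta> I (reals s3 7) j (set I) (reals s3 7 j) (nats s3 5 j)) \<and>
      start_ok J \<delta> I (set I) s3" for s3
  proof (rule ends_loop_free)
    note same = same_exceptD[OF s3[THEN conjunct1]]
    have "policy_memory J \<delta> a (reals s3 7 J / a\<^sup>2) (reals s3 7) (nats s3 5) (C + \<epsilon>, nats s3 4 0)
        (sem plan_finish s3)"
      using s2 by (simp add: policy_memory_def plan_finish_def decision_def same power2_eq_square)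
    then show "?Q (sem plan_finish s3)"
      using s3 unfolding start_ok_def by blast
  qed (simp_all add: plan_finish_def)
  show ?thesis
    unfolding plan_prog_def seq.simps s0_def[symmetric]
  proof (rule ends_Seq)
    show "ends mesh_prog s0 (2 * J + 1) (\<lambda>s'. s' = s1)"
      unfolding J_def s1_def using s0 \<epsilon> by (intro ends_mesh_prog)
    show "ends (Seq plan_init (Seq (While (NLess (nvar 7) (nvar 3)) grid_point_prog) plan_finish)) s'
      (J * (input_size I * (2 * J + 60)) + 9) ?Q" if "s' = s1" for s'
    proof (rule ends_Seq_loop_free)
      show "ends (Seq (While (NLess (nvar 7) (nvar 3)) grid_point_prog) plan_finish) (sem plan_init s')
        (J * (input_size I * (2 * J + 60)) + 3) ?Q"
        unfolding that s2_def[symmetric] by (rule ends_Seq[OF points finish]) auto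
    qed (simp_all add: plan_init_def)
  qed simp
qed

text \<open>Constant factors pass through the supremum, so bounding every finite horizon
  suffices.\<close>

lemma ennreal_mult_OPT_le:
  assumes "valid_instance C I" "\<And>k. ennreal (r * opt_value I k cap) \<le> S" "0 \<le> r"
  shows "ennreal r * OPT I cap \<le> S"
proof -
  have "ennreal r * OPT I cap \<le> ennreal r * (SUP k. ennreal (opt_value I k cap))"
    by (intro mult_left_mono OPT_le[OF assms(1)]) simp
  also have "\<dots> = (SUP k. ennreal (r * opt_value I k cap))"
    using assms(3) opt_value_nonneg[OF assms(1)] by (simp add: SUP_mult_left_ennreal ennreal_mult)
  also have "\<dots> \<le> S"
    by (intro SUP_least assms(2))
  finally show ?thesis .
qed

theorem theorem11:
  shows "\<exists>(plan :: com) (step :: com) (d :: nat). \<forall>C \<ge> (0::real). \<exists>K :: real.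
    \<forall>(\<epsilon> :: real) (I :: item_type list). \<epsilon> > 0 \<longrightarrow> valid_instance C I \<longrightarrow>
      (\<exists>\<pi> \<in> policies I.
         finds_policy plan step C \<epsilon> I (K * real (input_size I) * (1 + 1 / \<epsilon>) ^ d) \<pi> (C + \<epsilon>) \<and>
         policy_value I (C + \<epsilon>) \<pi> \<ge> ennreal (1 - \<epsilon>) * OPT I C)"
proof (rule exI[of _ plan_prog], rule exI[of _ step_prog], rule exI[of _ 6], intro allI impI)
  fix C :: real
  assume C: "0 \<le> C"
  \<comment> \<open>The time is at most 100 times the input size times \<open>(J + 1)^2\<close>;
    squaring \<open>mesh_count_le\<close> gives the rest.\<close>
  let ?K = "100 * (2 + 8 * (C + 1)\<^sup>2)\<^sup>2"
  have "\<exists>\<pi> \<in> policies I.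
      finds_policy plan_prog step_prog C \<epsilon> I (?K * real (input_size I) * (1 + 1 / \<epsilon>) ^ 6) \<pi> (C + \<epsilon>) \<and>
      policy_value I (C + \<epsilon>) \<pi> \<ge> ennreal (1 - \<epsilon>) * OPT I C"
    if \<epsilon>: "\<epsilon> > 0" and valid: "valid_instance C I" for \<epsilon> :: real and I :: "item_type list"
  proof -
    define J where "J = mesh_count C \<epsilon>"
    define a where "a = \<epsilon> / 2"
    define \<delta> where "\<delta> = (C + a) / real J"
    let ?S = "input_size I" and ?T = "?K * real (input_size I) * (1 + 1 / \<epsilon>) ^ 6"
    have J: "0 < J"
      unfolding J_def using C \<epsilon> by (rule mesh_count_pos)
    have a: "0 < a"
      using \<epsilon> by (simp add: a_def)
    have J\<delta>: "real J * \<delta> = C + a"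
      using J by (simp add: \<delta>_def)
    have \<delta>: "0 < \<delta>"
      using C a J by (simp add: \<delta>_def)
    interpret grid C \<delta> J I
      using C \<delta> valid J\<delta> a by unfold_locales auto
    have time: "real (100 * (?S * (J + 1)\<^sup>2)) \<le> ?T"
    proof -
      have "real (100 * (?S * (J + 1)\<^sup>2)) = 100 * (real ?S * (real J + 1)\<^sup>2)"
        by simp
      also have "\<dots> \<le> 100 * (real ?S * ((2 + 8 * (C + 1)\<^sup>2) * (1 + 1 / \<epsilon>) ^ 3)\<^sup>2)"
        using mesh_count_le[OF C \<epsilon>] by (intro mult_left_mono power_mono) (auto simp: J_def)
      also have "\<dots> = ?T"
        by (simp add: power_mult_distrib flip: power_mult)
      finally show ?thesis .
    qed
    have S: "1 \<le> ?S"
      using valid length_le_input_size[OF valid] by (cases I) (auto simp: valid_instance_def)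
    have S_le: "x \<le> ?S * x" for x
      using S by simp
    have "2 * J + J * (?S * (2 * J + 60)) + 10 \<le> ?S * (2 * J + 10) + J * (?S * (2 * J + 60))"
      using S_le[of "2 * J + 10"] by simp
    also have "\<dots> \<le> 100 * (?S * (J + 1)\<^sup>2)"
      by (simp add: power2_eq_square algebra_simps)
    finally have "real (2 * J + J * (?S * (2 * J + 60)) + 10) \<le> ?T"
      using time by linarith
    moreover
    have "2 * J + 12 \<le> 100 * (J + 1)\<^sup>2"
      by (simp add: power2_eq_square)
    then have "2 * J + 12 \<le> 100 * (?S * (J + 1)\<^sup>2)"
      using S_le[of "(J + 1)\<^sup>2"] by linarith
    then have step_time: "real (2 * J + 12) \<le> ?T"
      using time by linarith
    moreover obtain t s v best j where plan:
        "exec plan_prog (initial_memory C \<epsilon> I) t s" "t \<le> 2 * J + J * (?S * (2 * J + 60)) + 10"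
        "policy_memory J \<delta> a (v J / a\<^sup>2) v best (C + \<epsilon>, j) s" "v 0 = 0"
        "\<And>j. 0 < j \<Longrightarrow> j \<le> J \<Longrightarrow> optimal_choice J \<delta> I v j (set I) (v j) (best j)" "best 0 < length I"
        "j = J \<and> (\<forall>b\<in>set I. turn J \<delta> b = 0 \<longrightarrow> expect b (\<lambda>x p. p) \<le> 0) \<or>
         j = 0 \<and> turn J \<delta> (I ! best 0) = 0 \<and> 0 < expect (I ! best 0) (\<lambda>x p. p)"
      using ends_plan_prog[OF grid_axioms[unfolded \<delta>_def a_def J_def] \<epsilon>]
      unfolding ends_def \<delta>_def[symmetric] a_def[symmetric] J_def[symmetric] by blast
    ultimately have "real t \<le> ?T"
      by linarith
    let ?\<pi> = "grid_policy J \<delta> a (v J / a\<^sup>2) v best (C + \<epsilon>, j)"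
    have "j \<le> J"
      using plan(7) by auto
    then have best: "best i < length I" if "i \<le> j" for i
      using plan(5)[of i] plan(6) that by (cases "i = 0") (auto simp: optimal_choice_def)
    have pol: "?\<pi> \<in> policies I"
      using best by (intro grid_policy_in_policies) simp
    have "\<exists>s'. responds step_prog ?T s h s' \<and> decision s' = ?\<pi> h" for h
      using responds_step_prog[OF plan(3) \<delta> step_time, of h] by (auto simp: policy_memory_def grid_policy_def)
    then have finds: "finds_policy plan_prog step_prog C \<epsilon> I ?T ?\<pi> (C + \<epsilon>)"
      unfolding finds_policy_def using plan(1) \<open>real t \<le> ?T\<close> by blast
    have "ennreal (1 - \<epsilon>) * OPT I C \<le> policy_value I (C + \<epsilon>) ?\<pi>"
      using plan(7)
    proof (elim disjE conjE)
      assume "j = 0" "turn J \<delta> (I ! best 0) = 0" "0 < expect (I ! best 0) (\<lambda>x p. p)"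
      then have "policy_value I (C + \<epsilon>) ?\<pi> = \<infinity>"
        using policy_value_free[of "I ! best 0" "best 0" "C + \<epsilon>"] plan(6) C \<epsilon>
        by (simp add: grid_policy_dead)
      then show ?thesis
        by simp
    next
      assume "j = J" "\<forall>b\<in>set I. turn J \<delta> b = 0 \<longrightarrow> expect b (\<lambda>x p. p) \<le> 0"
      then interpret grid_solution C \<delta> J I v best
        using plan(4,5) by unfold_locales auto
      show ?thesis
      proof (cases "\<epsilon> < 1")
        \<comment> \<open>For \<open>\<epsilon> \<ge> 1\<close>, \<open>ennreal\<close> truncates
          the factor \<open>1 - \<epsilon>\<close> to 0.\<close>
        case False
        then show ?thesis
          by (simp add: ennreal_neg)
      next
        case True
        have cap: "C + \<epsilon> = real J * \<delta> + a"
          by (simp add: J\<delta> a_def)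
        have "8 * ((C + \<epsilon>) * (C + a)) \<le> real J * (\<epsilon> * (\<epsilon> * \<epsilon>))"
          using mesh_count_ge[OF \<epsilon>, of C] by (simp add: J_def a_def)
        then have "\<delta> * (C + \<epsilon>) \<le> \<epsilon> * (\<epsilon> * \<epsilon>) / 8"
          using J by (simp add: \<delta>_def divide_simps mult_ac)
        then have \<delta>_le: "\<delta> * (C + \<epsilon>) \<le> \<epsilon> / 2 * a\<^sup>2"
          by (simp add: a_def power2_eq_square)
        have "\<delta> * C \<le> \<delta> * (C + \<epsilon>)"
          using \<delta> \<epsilon> by (intro mult_left_mono) auto
        then have opt: "(1 - \<epsilon> / 2) * opt_value I k C \<le> v J" for k
          using True a J\<delta> \<delta>_le by (intro opt_le[where a = a]) auto
        have "\<delta> * (C + \<epsilon>) / a\<^sup>2 \<le> \<epsilon> / 2"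
          using \<delta>_le a by (simp add: pos_divide_le_eq)
        then have "v J * (1 - \<epsilon> / 2) \<le> v J * (1 - \<delta> * (C + \<epsilon>) / a\<^sup>2)"
          using v_nonneg[of J] by (intro mult_left_mono) auto
        moreover have "(1 - \<epsilon>) * opt_value I k C \<le> v J * (1 - \<epsilon> / 2)" for k
        proof -
          \<comment> \<open>Each direction of the simulation keeps a factor
            \<open>1 - \<epsilon> / 2\<close>, and the square of it is at least
            \<open>1 - \<epsilon>\<close>.\<close>
          have "(1 - \<epsilon>) * opt_value I k C \<le> ((1 - \<epsilon> / 2) * (1 - \<epsilon> / 2)) * opt_value I k C"
            by (intro mult_right_mono opt_value_nonneg[OF valid]) (simp add: algebra_simps)
          also have "\<dots> = (1 - \<epsilon> / 2) * opt_value I k C * (1 - \<epsilon> / 2)"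
            by simp
          also have "\<dots> \<le> v J * (1 - \<epsilon> / 2)"
            using True by (intro mult_right_mono opt) auto
          finally show ?thesis .
        qed
        ultimately have "(1 - \<epsilon>) * opt_value I k C \<le> v J * (1 - \<delta> * (C + \<epsilon>) / a\<^sup>2)" for k
          by (meson order_trans)
        then have "ennreal ((1 - \<epsilon>) * opt_value I k C) \<le> policy_value I (C + \<epsilon>) ?\<pi>" for k
          using policy_value_ge[OF a] pol \<open>j = J\<close> unfolding cap[symmetric]
          by (meson ennreal_leI order_trans)
        then show ?thesis
          using True by (intro ennreal_mult_OPT_le[OF valid]) auto
      qed
    qed
    then show ?thesis
      using pol finds by blast
  qed
  then show "\<exists>K. \<forall>\<epsilon> I. \<epsilon> > 0 \<longrightarrow> valid_instance C I \<longrightarrow> (\<exists>\<pi> \<in> policies I.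
      finds_policy plan_prog step_prog C \<epsilon> I (K * real (input_size I) * (1 + 1 / \<epsilon>) ^ 6) \<pi> (C + \<epsilon>) \<and>
      policy_value I (C + \<epsilon>) \<pi> \<ge> ennreal (1 - \<epsilon>) * OPT I C)"
    by blast
qed

end
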